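(* Let $G$ be a connected, compact Lie group of odd dimension and let $\mathfrak v\subset\mathfrak g_{\mathbb C}$ be a left-invariant CR structure of type CR1. Then the toral part of $\mathfrak v$ cannot satisfy the division condition (DC).
   Context: $\mathfrak g$ is the Lie algebra of $G$, $\mathfrak g_{\mathbb C}$ its complexification. Let $\mathbb T\subset G$ be a maximal torus with Lie algebra $\mathfrak t$, $d=\dim\mathbb T$, $\Delta$ the roots of $\mathfrak t_{\mathbb C}$ in $\mathfrak g_{\mathbb C}$, $\Delta_+$ a system of positive roots, $\mathfrak g_\alpha$ the root spaces. Type CR1. A subalgebra $\mathfrak v\subset\mathfrak g_{\mathbb C}$ is of type CR1 if for some such $\mathbb T,\Delta_+$ one has $$\mathfrak v=\mathfrak m\oplus\bigoplus_{\beta\in\Delta_+\setminus\{\alpha\}}\mathfrak g_\beta\oplus\operatorname{span}_{\mathbb C}\{t+x\},$$ where $\alpha\in\Delta_+$ is a simple root, $\mathfrak m\subset\ker\alpha\subset\mathfrak t_{\mathbb C}$ is a complex subspace of dimension $[d/2]$ (integer part) with $\mathfrak m\cap\mathfrak g=\{0\}$, $x\in\mathfrak g_\alpha\setminus\{0\}$ and $t\in\mathfrak t\setminus\{0\}$. In such a presentation, $\mathfrak m$ is called the toral part of $\mathfrak v$ and $\mathbb T$ the associated maximal torus. Condition (DC). Write $\mathbb T=\mathbb R^d/\mathbb Z^d$ with standard coordinates $x_1,\dots,x_d$. For $L=\sum_j a_j\,\partial/\partial x_j\in\mathfrak t_{\mathbb C}$ ($a_j\in\mathbb C$) put $\widehat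 L(\xi)=i\sum_j a_j\xi_j$, $\xi\in\mathbb Z^d$. $\mathfrak m$ satisfies (DC) if there are a basis $L_1,\dots,L_r$ of $\mathfrak m$ and constants $C,\rho>0$ with $\max_j|\widehat{L_j}(\xi)|\ge C(1+|\xi|)^{-\rho}$ for all $\xi\in\mathbb Z^d\setminus\{0\}$ (for $\mathfrak m=\{0\}$ and $d\geq 1$, (DC) is considered not satisfied). *)

theory Defs
  imports "HOL-Analysis.Analysis" "HOL-Algebra.Group" "HOL-Library.Function_Algebras"
begin

text \<open>
  For open \<open>S\<close> in a Euclidean space this is the class of \<open>k\<close> times continuously
  differentiable maps: all directional derivatives are again of class \<open>k - 1\<close>.
\<close>

primrec Ck_on :: "nat \<Rightarrow> 'a::euclidean_space set \<Rightarrow> ('a \<Rightarrow> 'b::euclidean_space) \<Rightarrow> bool" where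
  "Ck_on 0 S f = continuous_on S f"
| "Ck_on (Suc k) S f =
     ((\<forall>x\<in>S. f differentiable (at x)) \<and> (\<forall>v. Ck_on k S (\<lambda>x. frechet_derivative f (at x) v)))"

definition smooth_on :: "'a::euclidean_space set \<Rightarrow> ('a \<Rightarrow> 'b::euclidean_space) \<Rightarrow> bool" where
  "smooth_on S f \<longleftrightarrow> (\<forall>k. Ck_on k S f)"

text \<open>
  A chart is a pair of a domain and a map that is only relevant on that domain.
  Manifolds are whole types; the separation axioms are imposed by the type classes
  \<open>t2_space\<close> and \<open>second_countable_topology\<close>. The dimension is \<open>DIM('e)\<close>. Atlases are not
  required to be maximal.
\<close>

type_synonym ('m, 'e) chart = "'m set \<times> ('m \<Rightarrow> 'e)"

definition smooth_atlas ::
  "('m::{t2_space,second_countable_topology}, 'e::euclidean_space) chart set \<Rightarrow> bool" where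
  "smooth_atlas A \<longleftrightarrow>
     (\<Union>(U, c)\<in>A. U) = UNIV \<and>
     (\<forall>(U, c)\<in>A. open U \<and> open (c ` U) \<and> homeomorphism U (c ` U) c (inv_into U c)) \<and>
     (\<forall>(U, c)\<in>A. \<forall>(V, c')\<in>A. smooth_on (c ` (U \<inter> V)) (c' \<circ> inv_into U c))"

definition euclidean_atlas :: "('e::euclidean_space, 'e) chart set" where
  "euclidean_atlas = {(UNIV, id)}"

definition product_atlas ::
  "('m, 'e) chart set \<Rightarrow> ('n, 'f) chart set \<Rightarrow> ('m \<times> 'n, 'e \<times> 'f) chart set" where
  "product_atlas A B = {(U \<times> V, map_prod c c') | U c V c'. (U, c) \<in> A \<and> (V, c') \<in> B}"

definition smooth_map ::
  "('m::topological_space, 'e::euclidean_space) chart set \<Rightarrow>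
   ('n::topological_space, 'f::euclidean_space) chart set \<Rightarrow> ('m \<Rightarrow> 'n) \<Rightarrow> bool" where
  "smooth_map A B f \<longleftrightarrow>
     continuous_on UNIV f \<and>
     (\<forall>(U, c)\<in>A. \<forall>(V, c')\<in>B. smooth_on (c ` (U \<inter> f -` V)) (c' \<circ> f \<circ> inv_into U c))"

record ('g, 'e) lie_data = "'g monoid" +
  atlas :: "('g, 'e) chart set"

definition lie_group ::
  "('g::{t2_space,second_countable_topology}, 'e::euclidean_space) lie_data \<Rightarrow> bool" where
  "lie_group G \<longleftrightarrow>
     group G \<and> carrier G = UNIV \<and> smooth_atlas (atlas G) \<and>
     smooth_map (product_atlas (atlas G) (atlas G)) (atlas G) (\<lambda>(x, y). x \<otimes>\<^bsub>G\<^esub> y) \<and>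
     smooth_map (atlas G) (atlas G) (\<lambda>x. inv\<^bsub>G\<^esub> x)"

text \<open>
  Complex vector fields are represented as derivations of the algebra of smooth complex-valued
  functions. As operators on all functions they are normalised to be \<open>0\<close> on non-smooth ones.
\<close>

type_synonym 'g vfield = "('g \<Rightarrow> complex) \<Rightarrow> ('g \<Rightarrow> complex)"

definition cscale :: "complex \<Rightarrow> 'g vfield \<Rightarrow> 'g vfield" where
  "cscale a X = (\<lambda>f x. a * X f x)"

definition rscale :: "real \<Rightarrow> 'g vfield \<Rightarrow> 'g vfield" where
  "rscale a X = cscale (of_real a) X"

global_interpretation cvf: vector_space "cscale :: complex \<Rightarrow> 'g vfield \<Rightarrow> 'g vfield"
  by unfold_locales (auto simp: cscale_def fun_eq_iff algebra_simps)

global_interpretation rvf: vector_space "rscale :: real \<Rightarrow> 'g vfield \<Rightarrow> 'g vfield"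
  by unfold_locales (auto simp: rscale_def cscale_def fun_eq_iff algebra_simps)

definition smooth_functions ::
  "('g::{t2_space,second_countable_topology}, 'e::euclidean_space) lie_data \<Rightarrow> ('g \<Rightarrow> complex) set" where
  "smooth_functions G = {f. smooth_map (atlas G) euclidean_atlas f}"

text \<open>
  The Lie algebra consists of the left-invariant vector fields. Its elements are extended
  complex linearly to complex-valued functions; being real means preserving real-valued functions.
\<close>

definition lie_algebra ::
  "('g::{t2_space,second_countable_topology}, 'e::euclidean_space) lie_data \<Rightarrow> 'g vfield set" where
  "lie_algebra G = {X.
     (\<forall>f. f \<notin> smooth_functions G \<longrightarrow> X f = 0) \<and>
     (\<forall>f\<in>smooth_functions G. X f \<in> smooth_functions G) \<and>
     (\<forall>f\<in>smooth_functions G. \<forall>h\<in>smooth_functions G. X (f + h) = X f + X h) \<and>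
     (\<forall>a. \<forall>f\<in>smooth_functions G. X (\<lambda>x. a * f x) = (\<lambda>x. a * X f x)) \<and>
     (\<forall>f\<in>smooth_functions G. \<forall>h\<in>smooth_functions G. X (f * h) = X f * h + f * X h) \<and>
     (\<forall>f\<in>smooth_functions G. (\<forall>x. f x \<in> \<real>) \<longrightarrow> (\<forall>x. X f x \<in> \<real>)) \<and>
     (\<forall>a. \<forall>f\<in>smooth_functions G. X (\<lambda>x. f (a \<otimes>\<^bsub>G\<^esub> x)) = (\<lambda>x. X f (a \<otimes>\<^bsub>G\<^esub> x)))}"

definition complexification :: "'g vfield set \<Rightarrow> 'g vfield set" where
  "complexification V = {X + cscale \<i> Y | X Y. X \<in> V \<and> Y \<in> V}"

definition lie_bracket :: "'g vfield \<Rightarrow> 'g vfield \<Rightarrow> 'g vfield" where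
  "lie_bracket X Y = (\<lambda>f. X (Y f) - Y (X f))"

definition conj_vfield :: "'g vfield \<Rightarrow> 'g vfield" where
  "conj_vfield X = (\<lambda>f x. cnj (X (\<lambda>y. cnj (f y)) x))"

definition complex_subalgebra ::
  "('g::{t2_space,second_countable_topology}, 'e::euclidean_space) lie_data \<Rightarrow> 'g vfield set \<Rightarrow> bool" where
  "complex_subalgebra G v \<longleftrightarrow>
     v \<subseteq> complexification (lie_algebra G) \<and> cvf.subspace v \<and>
     (\<forall>X\<in>v. \<forall>Y\<in>v. lie_bracket X Y \<in> v)"

definition left_invariant_CR_structure ::
  "('g::{t2_space,second_countable_topology}, 'e::euclidean_space) lie_data \<Rightarrow> 'g vfield set \<Rightarrow> bool" where
  "left_invariant_CR_structure G v \<longleftrightarrow> complex_subalgebra G v \<and> v \<inter> conj_vfield ` v = {0}"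

text \<open>
  A torus is a compact connected abelian subgroup; closed subgroups of Lie groups are Lie groups.
\<close>

definition torus ::
  "('g::{t2_space,second_countable_topology}, 'e::euclidean_space) lie_data \<Rightarrow> 'g set \<Rightarrow> bool" where
  "torus G T \<longleftrightarrow>
     subgroup T G \<and> (\<forall>x\<in>T. \<forall>y\<in>T. x \<otimes>\<^bsub>G\<^esub> y = y \<otimes>\<^bsub>G\<^esub> x) \<and> compact T \<and> connected T"

definition maximal_torus ::
  "('g::{t2_space,second_countable_topology}, 'e::euclidean_space) lie_data \<Rightarrow> 'g set \<Rightarrow> bool" where
  "maximal_torus G T \<longleftrightarrow> torus G T \<and> (\<forall>S. torus G S \<and> T \<subseteq> S \<longrightarrow> S = T)"

definition one_parameter_subgroup ::
  "('g::{t2_space,second_countable_topology}, 'e::euclidean_space) lie_data \<Rightarrow> (real \<Rightarrow> 'g) \<Rightarrow> bool" where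
  "one_parameter_subgroup G \<gamma> \<longleftrightarrow>
     smooth_map euclidean_atlas (atlas G) \<gamma> \<and> (\<forall>s r. \<gamma> (s + r) = \<gamma> s \<otimes>\<^bsub>G\<^esub> \<gamma> r)"

text \<open>
  The Lie algebra of a closed subgroup \<open>T\<close>: the left-invariant fields \<open>X\<close> for which
  \<open>s \<mapsto> exp (s X)\<close> stays in \<open>T\<close>.
\<close>

definition subgroup_lie_algebra ::
  "('g::{t2_space,second_countable_topology}, 'e::euclidean_space) lie_data \<Rightarrow> 'g set \<Rightarrow> 'g vfield set" where
  "subgroup_lie_algebra G T = {X \<in> lie_algebra G.
     \<exists>\<gamma>. one_parameter_subgroup G \<gamma> \<and> range \<gamma> \<subseteq> T \<and>
       (\<forall>f\<in>smooth_functions G. \<forall>x.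
          ((\<lambda>s. f (x \<otimes>\<^bsub>G\<^esub> \<gamma> s)) has_vector_derivative X f x) (at 0))}"

definition cartan ::
  "('g::{t2_space,second_countable_topology}, 'e::euclidean_space) lie_data \<Rightarrow> 'g set \<Rightarrow> 'g vfield set" where
  "cartan G T = complexification (subgroup_lie_algebra G T)"

text \<open>
  Linear functionals on the complexified Lie algebra of \<open>T\<close> are total functions normalised
  to be \<open>0\<close> outside of it, so that they can be compared, added and negated pointwise.
\<close>

definition cartan_dual ::
  "('g::{t2_space,second_countable_topology}, 'e::euclidean_space) lie_data \<Rightarrow> 'g set \<Rightarrow>
   ('g vfield \<Rightarrow> complex) set" where
  "cartan_dual G T = {\<alpha>.
     (\<forall>H\<in>cartan G T. \<forall>K\<in>cartan G T. \<alpha> (H + K) = \<alpha> H + \<alpha> K) \<and>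
     (\<forall>a. \<forall>H\<in>cartan G T. \<alpha> (cscale a H) = a * \<alpha> H) \<and>
     (\<forall>H. H \<notin> cartan G T \<longrightarrow> \<alpha> H = 0)}"

definition root_space ::
  "('g::{t2_space,second_countable_topology}, 'e::euclidean_space) lie_data \<Rightarrow> 'g set \<Rightarrow>
   ('g vfield \<Rightarrow> complex) \<Rightarrow> 'g vfield set" where
  "root_space G T \<alpha> = {X \<in> complexification (lie_algebra G).
     \<forall>H\<in>cartan G T. lie_bracket H X = cscale (\<alpha> H) X}"

definition roots ::
  "('g::{t2_space,second_countable_topology}, 'e::euclidean_space) lie_data \<Rightarrow> 'g set \<Rightarrow>
   ('g vfield \<Rightarrow> complex) set" where
  "roots G T = {\<alpha> \<in> cartan_dual G T. \<alpha> \<noteq> 0 \<and> root_space G T \<alpha> \<noteq> {0}}"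

definition positive_system ::
  "('g::{t2_space,second_countable_topology}, 'e::euclidean_space) lie_data \<Rightarrow> 'g set \<Rightarrow>
   ('g vfield \<Rightarrow> complex) set \<Rightarrow> bool" where
  "positive_system G T P \<longleftrightarrow>
     P \<subseteq> roots G T \<and>
     (\<forall>\<alpha>\<in>roots G T. (\<alpha> \<in> P) \<noteq> (- \<alpha> \<in> P)) \<and>
     (\<forall>\<alpha>\<in>P. \<forall>\<beta>\<in>P. \<alpha> + \<beta> \<in> roots G T \<longrightarrow> \<alpha> + \<beta> \<in> P)"

definition simple_root :: "('g vfield \<Rightarrow> complex) set \<Rightarrow> ('g vfield \<Rightarrow> complex) \<Rightarrow> bool" where
  "simple_root P \<alpha> \<longleftrightarrow> \<alpha> \<in> P \<and> (\<nexists>\<beta> \<gamma>. \<beta> \<in> P \<and> \<gamma> \<in> P \<and> \<alpha> = \<beta> + \<gamma>)"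

definition internal_direct_sum :: "'i set \<Rightarrow> ('i \<Rightarrow> 'g vfield set) \<Rightarrow> 'g vfield set \<Rightarrow> bool" where
  "internal_direct_sum I W V \<longleftrightarrow>
     V = {\<Sum>i\<in>F. w i | F w. finite F \<and> F \<subseteq> I \<and> (\<forall>i\<in>F. w i \<in> W i)} \<and>
     (\<forall>F w. finite F \<and> F \<subseteq> I \<and> (\<forall>i\<in>F. w i \<in> W i) \<and> (\<Sum>i\<in>F. w i) = 0 \<longrightarrow> (\<forall>i\<in>F. w i = 0))"

definition CR1_presentation ::
  "('g::{t2_space,second_countable_topology}, 'e::euclidean_space) lie_data \<Rightarrow> 'g vfield set \<Rightarrow>
   'g set \<Rightarrow> ('g vfield \<Rightarrow> complex) set \<Rightarrow> ('g vfield \<Rightarrow> complex) \<Rightarrow> 'g vfield set \<Rightarrow>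
   'g vfield \<Rightarrow> 'g vfield \<Rightarrow> bool" where
  "CR1_presentation G v T P \<alpha> m t x \<longleftrightarrow>
     maximal_torus G T \<and> positive_system G T P \<and> simple_root P \<alpha> \<and>
     cvf.subspace m \<and> m \<subseteq> {H \<in> cartan G T. \<alpha> H = 0} \<and>
     cvf.dim m = rvf.dim (subgroup_lie_algebra G T) div 2 \<and>
     m \<inter> lie_algebra G = {0} \<and>
     x \<in> root_space G T \<alpha> - {0} \<and> t \<in> subgroup_lie_algebra G T - {0} \<and>
     (\<exists>n. internal_direct_sum (P - {\<alpha>}) (root_space G T) n \<and>
          internal_direct_sum {..<3::nat} (\<lambda>i. [m, n, cvf.span {t + x}] ! i) v)"

definition type_CR1 ::
  "('g::{t2_space,second_countable_topology}, 'e::euclidean_space) lie_data \<Rightarrow> 'g vfield set \<Rightarrow> bool" where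
  "type_CR1 G v \<longleftrightarrow>
     complex_subalgebra G v \<and> (\<exists>T P \<alpha> m t x. CR1_presentation G v T P \<alpha> m t x)"

definition toral_part ::
  "('g::{t2_space,second_countable_topology}, 'e::euclidean_space) lie_data \<Rightarrow> 'g vfield set \<Rightarrow>
   'g set \<Rightarrow> 'g vfield set \<Rightarrow> bool" where
  "toral_part G v T m \<longleftrightarrow> (\<exists>P \<alpha> t x. CR1_presentation G v T P \<alpha> m t x)"

text \<open>
  An identification of \<open>T\<close> with \<open>\<real>\<^sup>d / \<int>\<^sup>d\<close>, given as a smooth homomorphism from \<open>\<real>\<^sup>d\<close> onto \<open>T\<close>
  with kernel \<open>\<int>\<^sup>d\<close>. (A bijective smooth homomorphism of Lie groups is a diffeomorphism.)
\<close>

definition torus_coordinates ::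
  "('g::{t2_space,second_countable_topology}, 'e::euclidean_space) lie_data \<Rightarrow> 'g set \<Rightarrow>
   (real ^ 'd \<Rightarrow> 'g) \<Rightarrow> bool" where
  "torus_coordinates G T \<phi> \<longleftrightarrow>
     smooth_map euclidean_atlas (atlas G) \<phi> \<and>
     (\<forall>u w. \<phi> (u + w) = \<phi> u \<otimes>\<^bsub>G\<^esub> \<phi> w) \<and> range \<phi> = T \<and>
     (\<forall>u. \<phi> u = \<one>\<^bsub>G\<^esub> \<longleftrightarrow> (\<forall>j. u $ j \<in> \<int>))"

text \<open>
  The coordinate field \<open>\<partial>/\<partial>x\<^sub>j\<close> of the torus, extended to a left-invariant vector field on \<open>G\<close>.
\<close>

definition coordinate_field ::
  "('g::{t2_space,second_countable_topology}, 'e::euclidean_space) lie_data \<Rightarrow> (real ^ 'd \<Rightarrow> 'g) \<Rightarrow>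
   'd \<Rightarrow> 'g vfield" where
  "coordinate_field G \<phi> j = (\<lambda>f x.
     if f \<in> smooth_functions G
     then vector_derivative (\<lambda>s. f (x \<otimes>\<^bsub>G\<^esub> \<phi> (axis j s))) (at 0) else 0)"

definition toral_field ::
  "('g::{t2_space,second_countable_topology}, 'e::euclidean_space) lie_data \<Rightarrow> (real ^ 'd \<Rightarrow> 'g) \<Rightarrow>
   complex ^ 'd \<Rightarrow> 'g vfield" where
  "toral_field G \<phi> a = (\<Sum>j\<in>UNIV. cscale (a $ j) (coordinate_field G \<phi> j))"

definition toral_symbol :: "complex ^ 'd \<Rightarrow> int ^ 'd \<Rightarrow> complex" where
  "toral_symbol a \<xi> = \<i> * (\<Sum>j\<in>UNIV. a $ j * of_int (\<xi> $ j))"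

definition int_vec_norm :: "int ^ 'd \<Rightarrow> real" where
  "int_vec_norm \<xi> = norm (\<chi> j. real_of_int (\<xi> $ j))"

text \<open>
  \<open>A\<close> is the set of coefficient vectors of the members of a basis of \<open>m\<close>. Since \<open>'d\<close> is
  nonempty, \<open>m = {0}\<close> always falls under the convention that the condition then fails.
\<close>

definition division_condition ::
  "('g::{t2_space,second_countable_topology}, 'e::euclidean_space) lie_data \<Rightarrow> (real ^ 'd \<Rightarrow> 'g) \<Rightarrow>
   'g vfield set \<Rightarrow> bool" where
  "division_condition G \<phi> m \<longleftrightarrow> m \<noteq> {0} \<and>
     (\<exists>A C \<rho>. finite A \<and> inj_on (toral_field G \<phi>) A \<and>
        cvf.independent (toral_field G \<phi> ` A) \<and> cvf.span (toral_field G \<phi> ` A) = m \<and>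
        C > 0 \<and> \<rho> > 0 \<and>
        (\<forall>\<xi>. \<xi> \<noteq> 0 \<longrightarrow>
           Max ((\<lambda>a. cmod (toral_symbol a \<xi>)) ` A) \<ge> C * (1 + int_vec_norm \<xi>) powr (- \<rho>)))"

end

theory Submission
  imports Defs
begin

text \<open>The toral part lies in the kernel of the root \<open>\<alpha>\<close>, and in the coordinates \<open>\<phi>\<close> a root is \<open>2 \<pi> i\<close> times
  a nonzero integer covector \<open>\<xi>\<close>. So all symbols of the toral part vanish at \<open>\<xi>\<close>, which contradicts (DC).

  For the integrality, let \<open>H\<close> be a coordinate field, let \<open>X\<close> be a root vector and \<open>[H, X] = \<theta> X\<close>. The flow of \<open>H\<close>
  is right translation by a circle. If \<open>exp \<theta> \<noteq> 1\<close>, solving \<open>(H - \<mu>) h = f\<close> along the circles, for suitable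
  constants \<open>\<mu>\<close>, shows that all Fourier coefficients of \<open>X f\<close> along the circles vanish for every smooth \<open>f\<close>,
  so \<open>X = 0\<close>. This way \<open>X\<close> is used only as a linear operator on the smooth functions, and the
  correspondence of derivations with tangent vectors is not required. The covector is nonzero since every one-parameter
  subgroup of the torus lifts to a line in \<open>\<real>\<^sup>d\<close>.\<close>

section \<open>Functions of class \<open>C\<^sup>k\<close>\<close>

lemma Ck_on_Suc_imp_Ck_on: "Ck_on (Suc k) S f \<Longrightarrow> Ck_on k S f"
proof (induction k arbitrary: f)
  case 0
  then show ?case
    by (auto intro!: continuous_at_imp_continuous_on differentiable_imp_continuous_within)
next
  case (Suc k)
  then show ?case by (metis Ck_on.simps(2))
qed

text \<open>Openness enters because a derivative at a point depends on the values near it, so that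
  agreement on \<open>S\<close> passes to all derivatives.\<close>

lemma Ck_on_cong:
  assumes "open S" "\<And>x. x \<in> S \<Longrightarrow> f x = g x" "Ck_on k S f"
  shows "Ck_on k S g"
  using assms(2,3)
proof (induction k arbitrary: f g)
  case 0
  then show ?case using continuous_on_cong by force
next
  case (Suc k)
  have d: "(g has_derivative frechet_derivative f (at x)) (at x)" if "x \<in> S" for x
    using Suc.prems that \<open>open S\<close>
    by (auto simp: frechet_derivative_works intro: has_derivative_transform_within_open)
  have eq: "frechet_derivative f (at x) v = frechet_derivative g (at x) v" if "x \<in> S" for x v
    using frechet_derivative_at[OF d[OF that]] by simp
  have "Ck_on k S (\<lambda>x. frechet_derivative g (at x) v)" for v
    by (rule Suc.IH[OF eq]) (use Suc.prems in auto)
  then show ?case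
    using d by (auto simp: differentiable_def)
qed

text \<open>Continuity on an open neighbourhood and differentiability are conditions at single
  points. This allows a chart around the value of a group product to be chosen anew near each
  point.\<close>

lemma Ck_on_local:
  assumes "\<And>x. x \<in> S \<Longrightarrow> \<exists>U. open U \<and> x \<in> U \<and> Ck_on k U f"
  shows "Ck_on k S f"
  using assms
proof (induction k arbitrary: f)
  case 0
  then show ?case
    by (metis Ck_on.simps(1) continuous_at_imp_continuous_on continuous_on_eq_continuous_at)
next
  case (Suc k)
  have "Ck_on k S (\<lambda>x. frechet_derivative f (at x) v)" for v
    by (rule Suc.IH) (use Suc.prems in fastforce)
  then show ?case using Suc.prems by fastforce
qed

lemma Ck_on_const: "Ck_on k S (\<lambda>x. c)"
  by (induction k arbitrary: c) (auto simp: frechet_derivative_const)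

lemma Ck_on_bounded_linear:
  assumes "bounded_linear f" shows "Ck_on k S f"
proof (cases k)
  case 0
  then show ?thesis using assms by (simp add: linear_continuous_on)
next
  case (Suc n)
  have "frechet_derivative f (at x) = f" for x
    using bounded_linear_imp_has_derivative[OF assms] frechet_derivative_at by metis
  then show ?thesis
    using Suc assms by (auto intro: Ck_on_const bounded_linear_imp_differentiable)
qed

lemma Ck_on_add:
  assumes "open S" "Ck_on k S f" "Ck_on k S g" shows "Ck_on k S (\<lambda>x. f x + g x)"
  using assms(2,3)
proof (induction k arbitrary: f g)
  case 0
  then show ?case by (auto intro: continuous_intros)
next
  case (Suc k)
  have d: "((\<lambda>x. f x + g x) has_derivative
      (\<lambda>v. frechet_derivative f (at x) v + frechet_derivative g (at x) v)) (at x)" if "x \<in> S" for x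
    using Suc.prems that by (intro has_derivative_add) (auto simp: frechet_derivative_works)
  have eq: "frechet_derivative f (at x) v + frechet_derivative g (at x) v =
      frechet_derivative (\<lambda>x. f x + g x) (at x) v" if "x \<in> S" for x v
    using fun_cong[OF frechet_derivative_at[OF d[OF that]]] .
  have "Ck_on k S (\<lambda>x. frechet_derivative (\<lambda>x. f x + g x) (at x) v)" for v
    by (rule Ck_on_cong[OF \<open>open S\<close> eq Suc.IH]) (use Suc.prems in auto)
  then show ?case using Suc.prems by auto
qed

lemma Ck_on_bounded_bilinear:
  assumes "bounded_bilinear p" "open S" "Ck_on k S f" "Ck_on k S g"
  shows "Ck_on k S (\<lambda>x. p (f x) (g x))"
  using assms(3,4)
proof (induction k arbitrary: f g)
  case 0
  then show ?case using bounded_bilinear.continuous_on[OF assms(1)] by auto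
next
  case (Suc k)
  have d: "((\<lambda>x. p (f x) (g x)) has_derivative
      (\<lambda>v. p (f x) (frechet_derivative g (at x) v) + p (frechet_derivative f (at x) v) (g x))) (at x)"
    if "x \<in> S" for x
    using Suc.prems that by (intro bounded_bilinear.FDERIV[OF assms(1)])
      (auto simp: frechet_derivative_works)
  have eq: "p (f x) (frechet_derivative g (at x) v) + p (frechet_derivative f (at x) v) (g x) =
      frechet_derivative (\<lambda>x. p (f x) (g x)) (at x) v" if "x \<in> S" for x v
    using fun_cong[OF frechet_derivative_at[OF d[OF that]]] .
  have "Ck_on k S (\<lambda>x. frechet_derivative (\<lambda>x. p (f x) (g x)) (at x) v)" for v
    by (rule Ck_on_cong[OF \<open>open S\<close> eq Ck_on_add[OF \<open>open S\<close> Suc.IH Suc.IH]])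
      (use Suc.prems Ck_on_Suc_imp_Ck_on[OF Suc.prems(1)] Ck_on_Suc_imp_Ck_on[OF Suc.prems(2)] in auto)
  then show ?case using d by (auto simp: differentiable_def)
qed

lemma Ck_on_sum:
  assumes "open S" "finite I" "\<And>i. i \<in> I \<Longrightarrow> Ck_on k S (f i)"
  shows "Ck_on k S (\<lambda>x. \<Sum>i\<in>I. f i x)"
  using assms(2,3)
  by (induction I rule: finite_induct) (auto intro: Ck_on_const Ck_on_add[OF assms(1)])

lemma Ck_on_linear_compose:
  assumes "bounded_linear h" "open S" "Ck_on k S f"
  shows "Ck_on k S (\<lambda>x. h (f x))"
  using assms(3)
proof (induction k arbitrary: f)
  case 0
  then show ?case using bounded_linear.continuous_on[OF assms(1)] by auto
next
  case (Suc k)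
  have d: "((\<lambda>x. h (f x)) has_derivative (\<lambda>v. h (frechet_derivative f (at x) v))) (at x)"
    if "x \<in> S" for x
    using Suc.prems that by (intro bounded_linear.has_derivative[OF assms(1)])
      (auto simp: frechet_derivative_works)
  have eq: "h (frechet_derivative f (at x) v) =
      frechet_derivative (\<lambda>x. h (f x)) (at x) v" if "x \<in> S" for x v
    using fun_cong[OF frechet_derivative_at[OF d[OF that]]] .
  have "Ck_on k S (\<lambda>x. frechet_derivative (\<lambda>x. h (f x)) (at x) v)" for v
    by (rule Ck_on_cong[OF \<open>open S\<close> eq Suc.IH]) (use Suc.prems in auto)
  then show ?case using d by (auto simp: differentiable_def)
qed

lemma Ck_on_compose:
  fixes f :: "'a::euclidean_space \<Rightarrow> 'b::euclidean_space" and g :: "'b \<Rightarrow> 'c::euclidean_space"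
  assumes "open S" "open T" "Ck_on k S f" "Ck_on k T g" "f ` S \<subseteq> T"
  shows "Ck_on k S (\<lambda>x. g (f x))"
  using assms(3,4)
proof (induction k arbitrary: g)
  case 0
  then show ?case using continuous_on_compose2[of T g S f] assms(5) by auto
next
  case (Suc k)
  define Df where "Df x = frechet_derivative f (at x)" for x
  define Dg where "Dg y = frechet_derivative g (at y)" for y
  have g: "(g has_derivative Dg (f x)) (at (f x))" if "x \<in> S" for x
    using Suc.prems(2) assms(5) that by (auto simp: frechet_derivative_works Dg_def)
  have d: "((\<lambda>x. g (f x)) has_derivative (\<lambda>v. Dg (f x) (Df x v))) (at x)" if "x \<in> S" for x
    by (rule has_derivative_compose[of f, OF _ g[OF that]])
      (use Suc.prems(1) that in \<open>auto simp: frechet_derivative_works Df_def\<close>)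
  \<comment> \<open>The chain rule produces the direction \<open>Df x v\<close>, which varies with
    \<open>x\<close>, whereas \<open>Ck_on\<close> controls \<open>Dg\<close> only in fixed
    directions. Expanding in the basis leaves finitely many fixed directions with coefficients
    depending on \<open>x\<close>.\<close>
  have eq: "(\<Sum>b\<in>Basis. (Df x v \<bullet> b) *\<^sub>R Dg (f x) b) = frechet_derivative (\<lambda>x. g (f x)) (at x) v"
    if "x \<in> S" for x v
  proof -
    have "(\<Sum>b\<in>Basis. (Df x v \<bullet> b) *\<^sub>R Dg (f x) b) = Dg (f x) (\<Sum>b\<in>Basis. (Df x v \<bullet> b) *\<^sub>R b)"
      using has_derivative_linear[OF g[OF that]] by (simp add: linear_sum linear_scale)
    then show ?thesis
      using frechet_derivative_at[OF d[OF that]] by (simp add: euclidean_representation fun_eq_iff)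
  qed
  have ck: "Ck_on k S (\<lambda>x. \<Sum>b\<in>Basis. (Df x v \<bullet> b) *\<^sub>R Dg (f x) b)" for v
    using Suc.prems
    by (intro Ck_on_sum Ck_on_bounded_bilinear[OF bounded_bilinear_scaleR] \<open>open S\<close> finite_Basis
        Ck_on_linear_compose[OF bounded_linear_inner_left] Suc.IH Ck_on_Suc_imp_Ck_on[OF Suc.prems(1)])
      (auto simp: Df_def Dg_def)
  have "Ck_on k S (\<lambda>x. frechet_derivative (\<lambda>x. g (f x)) (at x) v)" for v
    by (rule Ck_on_cong[OF \<open>open S\<close> eq ck])
  then show ?case using d by (auto simp: differentiable_def)
qed

lemma Ck_on_Pair:
  assumes "open S" "Ck_on k S f" "Ck_on k S g"
  shows "Ck_on k S (\<lambda>x. (f x, g x))"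
proof -
  have "Ck_on k S (\<lambda>x. (f x, 0) + (0, g x))"
    using Ck_on_linear_compose[OF bounded_linear_Pair[OF bounded_linear_ident bounded_linear_zero] assms(1,2)]
      Ck_on_linear_compose[OF bounded_linear_Pair[OF bounded_linear_zero bounded_linear_ident] assms(1,3)]
    by (intro Ck_on_add[OF assms(1)])
  then show ?thesis by simp
qed

text \<open>Differentiation under the integral sign: the derivative in direction \<open>v\<close> is
  again a parameter integral, whose integrand is the derivative of \<open>F\<close> in direction
  \<open>(v, 0)\<close>, so the induction hypothesis applies to it.\<close>

lemma Ck_on_parametric_integral:
  fixes F :: "'a::euclidean_space \<times> real \<Rightarrow> 'b::euclidean_space"
  assumes "open S" "Ck_on k (S \<times> UNIV) F"
  shows "Ck_on k S (\<lambda>y. integral {a..b} (\<lambda>r. F (y, r)))"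
  using assms(2)
proof (induction k arbitrary: F)
  case 0
  have *: "continuous_on (S \<times> cbox a b) (\<lambda>(y, r). F (y, r))"
    using 0 by (auto intro: continuous_on_subset)
  show ?case
    using integral_continuous_on_param[OF *] by simp
next
  case (Suc k)
  \<comment> \<open>The partial derivative in \<open>y\<close> is packaged as a bounded linear map,
    the form that \<open>leibniz_rule\<close> takes. Its continuity is checked on basis
    vectors.\<close>
  define D where "D y r = Blinfun (\<lambda>v. frechet_derivative F (at (y, r)) (v, 0))" for y r
  have F: "(F has_derivative frechet_derivative F (at (y, r))) (at (y, r))" if "y \<in> S" for y r
    using Suc.prems that by (auto simp: frechet_derivative_works)
  have lin: "bounded_linear (\<lambda>v. frechet_derivative F (at (y, r)) (v, 0))" if "y \<in> S" for y r
    by (rule bounded_linear_compose[OF has_derivative_bounded_linear[OF F[OF that]]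
        bounded_linear_Pair[OF bounded_linear_ident bounded_linear_zero]])
  have D: "blinfun_apply (D y r) = (\<lambda>v. frechet_derivative F (at (y, r)) (v, 0))" if "y \<in> S" for y r
    unfolding D_def using bounded_linear_Blinfun_apply[OF lin[OF that]] .
  have d: "((\<lambda>y. F (y, r)) has_derivative blinfun_apply (D y r)) (at y within U)" if "y \<in> S" for y r U
  proof -
    have "((\<lambda>y. (y, r)) has_derivative (\<lambda>v. (v, 0))) (at y within U)"
      by (auto intro!: derivative_eq_intros)
    from has_derivative_compose[OF this F[OF that]] show ?thesis using D[OF that] by simp
  qed
  have cont: "continuous_on (S \<times> cbox a b) (\<lambda>(y, r). D y r)"
  proof (rule continuous_on_blinfun_componentwise)
    fix i :: 'a
    have "Ck_on k (S \<times> UNIV) (\<lambda>p. frechet_derivative F (at p) (i, 0))" using Suc.prems by auto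
    then have "Ck_on 0 (S \<times> UNIV) (\<lambda>p. frechet_derivative F (at p) (i, 0))"
      by (induction k) (auto dest: Ck_on_Suc_imp_Ck_on simp del: Ck_on.simps)
    then have "continuous_on (S \<times> cbox a b) (\<lambda>p. frechet_derivative F (at p) (i, 0))"
      by (auto intro: continuous_on_subset)
    then show "continuous_on (S \<times> cbox a b) (\<lambda>p. blinfun_apply (case p of (y, r) \<Rightarrow> D y r) i)"
      by (rule continuous_on_eq) (auto simp: D)
  qed
  have contF: "continuous_on (S \<times> UNIV) F"
    using Suc.prems by (auto intro!: continuous_at_imp_continuous_on differentiable_imp_continuous_within)
  have int: "(\<lambda>r. F (y, r)) integrable_on cbox a b" if "y \<in> S" for y
    by (intro integrable_continuous continuous_on_compose2[OF contF] continuous_intros) (use that in auto)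
  have d': "((\<lambda>y. integral (cbox a b) (\<lambda>r. F (y, r))) has_derivative
      blinfun_apply (integral (cbox a b) (D y))) (at y)" if y: "y \<in> S" for y
  proof -
    obtain e where e: "e > 0" "ball y e \<subseteq> S" using \<open>open S\<close> y openE by blast
    have "((\<lambda>y. integral (cbox a b) (\<lambda>r. F (y, r))) has_derivative
        blinfun_apply (integral (cbox a b) (D y))) (at y within ball y e)"
      using e by (intro leibniz_rule[where fx = D] d int continuous_on_subset[OF cont]) auto
    then show ?thesis using at_within_open[of y "ball y e"] e by simp
  qed
  have app: "blinfun_apply (integral (cbox a b) (D y)) v =
      integral {a..b} (\<lambda>r. frechet_derivative F (at (y, r)) (v, 0))" if y: "y \<in> S" for y v
  proof -
    have "D y integrable_on cbox a b"
      by (intro integrable_continuous continuous_on_compose2[OF cont, of _ "\<lambda>r. (y, r)", simplified]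
          continuous_intros) (use y in auto)
    then have "integral (cbox a b) (\<lambda>r. blinfun_apply (D y r) v) = blinfun_apply (integral (cbox a b) (D y)) v"
      using integral_linear[of "D y" "cbox a b" "\<lambda>B. blinfun_apply B v"]
        blinfun.bounded_linear_left by (simp add: o_def)
    then show ?thesis using D[OF y] by simp
  qed
  have d: "((\<lambda>y. integral {a..b} (\<lambda>r. F (y, r))) has_derivative
      (\<lambda>v. integral {a..b} (\<lambda>r. frechet_derivative F (at (y, r)) (v, 0)))) (at y)" if y: "y \<in> S" for y
    using d'[OF y] ext[of "blinfun_apply (integral (cbox a b) (D y))", OF app[OF y]] by simp
  have eq: "integral {a..b} (\<lambda>r. frechet_derivative F (at (y, r)) (v, 0)) =
    frechet_derivative (\<lambda>y. integral {a..b} (\<lambda>r. F (y, r))) (at y) v" if "y \<in> S" for y v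
    using fun_cong[OF frechet_derivative_at[OF d[OF that]]] .
  have ck: "Ck_on k S (\<lambda>y. integral {a..b} (\<lambda>r. frechet_derivative F (at (y, r)) (v, 0)))" for v
    using Suc.IH[of "\<lambda>p. frechet_derivative F (at p) (v, 0)"] Suc.prems by simp
  have "Ck_on k S (\<lambda>y. frechet_derivative (\<lambda>y. integral {a..b} (\<lambda>r. F (y, r))) (at y) v)" for v
    by (rule Ck_on_cong[OF \<open>open S\<close> eq ck])
  then show ?case using d by (auto simp: differentiable_def)
qed

lemma Ck_on_exp_linear: "Ck_on k S (\<lambda>r::real. exp (of_real r * z :: complex))"
proof -
  \<comment> \<open>The constant \<open>c\<close> is kept free in the induction since each
    derivative contributes a further factor \<open>of_real v * z\<close>.\<close>
  have "Ck_on k S (\<lambda>r::real. c * exp (of_real r * z :: complex))" for c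
  proof (induction k arbitrary: c)
    case 0
    then show ?case by (auto intro!: continuous_intros)
  next
    case (Suc k)
    have d: "((\<lambda>r::real. c * exp (of_real r * z)) has_derivative
      (\<lambda>v. of_real v * z * c * exp (of_real r * z))) (at r)" for r
    proof -
      have "((\<lambda>r::real. of_real r * z) has_derivative (\<lambda>v. of_real v * z)) (at r)"
        by (intro bounded_linear_imp_has_derivative
            bounded_linear_compose[OF bounded_linear_mult_left bounded_linear_of_real])
      from has_derivative_compose[OF this DERIV_exp[THEN has_field_derivative_imp_has_derivative]]
      show ?thesis
        by (auto dest: has_derivative_mult_right[of _ _ _ c] simp: mult_ac)
    qed
    have "frechet_derivative (\<lambda>r::real. c * exp (of_real r * z)) (at r) v =
      of_real v * z * c * exp (of_real r * z)" for r v
      using fun_cong[OF frechet_derivative_at[OF d], symmetric] .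
    then show ?case using Suc.IH differentiableI[OF d] by auto
  qed
  from this[of 1] show ?thesis by simp
qed

section \<open>Vanishing Fourier coefficients\<close>

text \<open>The characters of the circle of length 1. Integration against
  \<open>fourier_char n\<close> without conjugation gives the Fourier coefficient at
  \<open>- n\<close>.\<close>

definition fourier_char :: "int \<Rightarrow> real \<Rightarrow> complex" where
  "fourier_char n s = exp (of_real s * (2 * of_int n * pi * \<i>))"

lemma fourier_char_mult: "fourier_char m s * fourier_char n s = fourier_char (m + n) s"
  by (simp add: fourier_char_def exp_add[symmetric] algebra_simps)

lemma continuous_on_fourier_char [continuous_intros]: "continuous_on S (fourier_char n)"
  unfolding fourier_char_def by (intro continuous_intros)

lemma fourier_char_1: "fourier_char 1 s = cis (2 * pi * s)" "fourier_char (- 1) s = cnj (cis (2 * pi * s))"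
  by (simp_all add: fourier_char_def cis_conv_exp exp_cnj mult_ac)

text \<open>Multiplication by a polynomial in \<open>cos\<close> and \<open>sin\<close> preserves the vanishing of all Fourier
  coefficients; this is the form in which an induction over the polynomial goes through.\<close>

lemma real_polynomial_fourier:
  fixes h :: "real \<Rightarrow> complex"
  assumes "real_polynomial_function p" "continuous_on UNIV h"
    "\<And>n. integral {0..1} (\<lambda>s. fourier_char n s * h s) = 0"
  shows "integral {0..1} (\<lambda>s. fourier_char n s * (of_real (p (cis (2 * pi * s))) * h s)) = 0"
  using assms
proof (induction p arbitrary: h n)
  case (linear p)
  define u v where "u = p 1" and "v = p \<i>"
  \<comment> \<open>A real linear functional has the form \<open>a * z + b * cnj z\<close>. On the
    circle, \<open>z\<close> and its conjugate are the characters of index 1 and -1, so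
    multiplication by the functional only shifts \<open>n\<close>.\<close>
  define a b where "a = (of_real u - \<i> * of_real v) / 2"
    and "b = (of_real u + \<i> * of_real v) / 2"
  have p: "p z = Re z * u + Im z * v" for z
  proof -
    have "p z = p (Re z *\<^sub>R 1 + Im z *\<^sub>R \<i>)"
      by (rule arg_cong[of _ _ p]) (simp add: complex_eq_iff)
    then show ?thesis
      by (simp only: linear_add linear_scale bounded_linear.linear[OF linear(1)] real_scaleR_def u_def v_def)
  qed
  have "of_real (p z) = a * z + b * cnj z" for z
    by (simp add: p complex_eq_iff a_def b_def field_simps)
  then have "fourier_char n s * (of_real (p (cis (2 * pi * s))) * h s) =
      a * (fourier_char (n + 1) s * h s) + b * (fourier_char (n + - 1) s * h s)" for s
    unfolding fourier_char_mult[symmetric] fourier_char_1 by (simp add: algebra_simps)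
  moreover have "(\<lambda>s. fourier_char m s * h s) integrable_on {0..1}" for m
    by (intro integrable_continuous_real continuous_intros continuous_on_subset[OF linear(2)]) auto
  ultimately show ?case
    using linear(3) by (simp add: integral_add integral_mult_right integrable_on_mult_right)
next
  case (const c)
  have "fourier_char n s * (of_real c * h s) = of_real c * (fourier_char n s * h s)" for s by simp
  then show ?case using const by (simp only: integral_mult_right mult_zero_right)
next
  case (add p q)
  have "continuous_on {0..1} (\<lambda>s. fourier_char n s * (of_real (r (cis (2 * pi * s))) * h s))"
    if "real_polynomial_function r" for r
    by (intro continuous_intros continuous_on_subset[OF add.prems(1)]
        continuous_on_compose2[OF continuous_on_polymonial_function[of r UNIV]])
      (use that in \<open>auto simp: real_polynomial_function_eq intro!: continuous_intros\<close>)
  then have "integral {0..1} (\<lambda>s. fourier_char n s * (of_real (p (cis (2 * pi * s))) * h s)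
      + fourier_char n s * (of_real (q (cis (2 * pi * s))) * h s)) = 0"
    using add by (simp add: integral_add integrable_continuous_real)
  then show ?case by (simp add: algebra_simps)
next
  case (mult p q)
  have "continuous_on UNIV (\<lambda>s. of_real (q (cis (2 * pi * s))) * h s)"
    by (intro continuous_intros mult.prems
        continuous_on_compose2[OF continuous_on_polymonial_function[of q UNIV]])
      (use mult.hyps in \<open>auto simp: real_polynomial_function_eq intro!: continuous_intros\<close>)
  from mult.IH(1)[OF this mult.IH(2)[OF mult.prems]] show ?case by (simp add: mult_ac)
qed

text \<open>The real part of \<open>g\<close> is approximated uniformly by a real polynomial
  \<open>p\<close> in cosine and sine. As \<open>p\<close> integrates to 0 against \<open>g\<close>,
  the integral of the square of \<open>Re (g s)\<close> equals that of the error times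
  \<open>Re (g s)\<close>, which is arbitrarily small. Real polynomials approximate real functions,
  hence the restriction to the real part.\<close>

lemma Re_zero_if_fourier_zero:
  fixes g :: "real \<Rightarrow> complex"
  assumes cont: "continuous_on UNIV g" and per: "g 1 = g 0"
    and zero: "\<And>n. integral {0..1} (\<lambda>s. fourier_char n s * g s) = 0"
    and s: "s \<in> {0..1}"
  shows "Re (g s) = 0"
proof -
  have contR: "continuous_on S (\<lambda>s. Re (g s))" for S
    using cont by (intro continuous_intros) (auto intro: continuous_on_subset)
  \<comment> \<open>The real part of \<open>g\<close> as a function on the unit circle.
    \<open>Arg2pi\<close> jumps at 1, and continuity there comes from \<open>g 1 = g 0\<close>
    through the correspondence of loops with maps of the circle.\<close>
  define f where "f = (\<lambda>s. Re (g s)) \<circ> (\<lambda>z. Arg2pi z / (2 * pi))"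
  have "homotopic_loops UNIV (\<lambda>s. Re (g s)) (\<lambda>s. Re (g s))"
    using contR per by (auto simp: homotopic_loops_refl path_def pathfinish_def pathstart_def)
  then have f: "continuous_on (sphere 0 1) f"
    using homotopic_loops_imp_homotopic_circlemaps homotopic_with_imp_continuous unfolding f_def by metis
  have f_eq: "f (cis (2 * pi * s)) = Re (g s)" if "s \<in> {0..1}" for s
  proof (cases "s = 1")
    case True
    moreover have "Arg2pi 1 = 0" using Arg2pi_of_real[of 1] by simp
    ultimately show ?thesis using per by (simp add: f_def)
  next
    case False
    then have "Arg2pi (cis (2 * pi * s)) = 2 * pi * s"
      using that by (intro Arg2pi_unique[of 1]) (auto simp: cis_conv_exp mult_ac)
    then show ?thesis by (simp add: f_def)
  qed
  \<comment> \<open>The bound turns a uniform error \<open>e / M\<close> of the approximation into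
    an error \<open>e\<close> of the integral.\<close>
  obtain M where M: "M > 0" "\<And>s. s \<in> {0..1} \<Longrightarrow> \<bar>Re (g s)\<bar> \<le> M"
    using compact_continuous_image[OF contR compact_Icc[of 0 1], THEN compact_imp_bounded]
    unfolding bounded_pos by auto
  have "integral {0..1} (\<lambda>s. (Re (g s))\<^sup>2) \<le> e" if "e > 0" for e
  proof -
    obtain p where p: "real_polynomial_function p" "\<And>z. z \<in> sphere 0 1 \<Longrightarrow> \<bar>f z - p z\<bar> < e / M"
      using Stone_Weierstrass_real_polynomial_function[OF compact_sphere f] \<open>e > 0\<close> M(1)
      by (metis divide_pos_pos)
    have contp: "continuous_on S (\<lambda>s. p (cis (2 * pi * s)))" for S
      by (intro continuous_on_compose2[OF continuous_on_polymonial_function[of p UNIV]])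
        (use p in \<open>auto simp: real_polynomial_function_eq intro!: continuous_intros\<close>)
    have "integral {0..1} (\<lambda>s. of_real (p (cis (2 * pi * s))) * g s) = 0"
      using real_polynomial_fourier[OF p(1) cont zero, of 0] by (simp add: fourier_char_def)
    moreover have "(\<lambda>s. of_real (p (cis (2 * pi * s))) * g s) integrable_on {0..1}"
      by (intro integrable_continuous_real continuous_intros contp continuous_on_subset[OF cont]) auto
    ultimately have 0: "integral {0..1} (\<lambda>s. p (cis (2 * pi * s)) * Re (g s)) = 0"
      using integral_linear[OF _ bounded_linear_Re] by (fastforce simp: o_def)
    have "integral {0..1} (\<lambda>s. (Re (g s))\<^sup>2) =
        integral {0..1} (\<lambda>s. (Re (g s) - p (cis (2 * pi * s))) * Re (g s) + p (cis (2 * pi * s)) * Re (g s))"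
      by (simp add: algebra_simps power2_eq_square)
    also have "\<dots> = integral {0..1} (\<lambda>s. (Re (g s) - p (cis (2 * pi * s))) * Re (g s))"
      using 0 by (subst integral_add)
        (auto intro!: integrable_continuous_real continuous_intros contp contR)
    also have "\<dots> \<le> integral {0..1::real} (\<lambda>s. e)"
    proof (rule integral_le)
      fix s :: real assume s: "s \<in> {0..1}"
      have "\<bar>Re (g s) - p (cis (2 * pi * s))\<bar> \<le> e / M"
        using p(2)[of "cis (2 * pi * s)"] f_eq[OF s] by simp
      then have "\<bar>Re (g s) - p (cis (2 * pi * s))\<bar> * \<bar>Re (g s)\<bar> \<le> e / M * M"
        using M s \<open>e > 0\<close> by (intro mult_mono) auto
      then show "(Re (g s) - p (cis (2 * pi * s))) * Re (g s) \<le> e"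
        using M(1) abs_le_D1 by (fastforce simp: abs_mult[symmetric])
    qed (intro integrable_continuous_real continuous_intros contp contR)+
    finally show ?thesis by simp
  qed
  then have "integral {0..1} (\<lambda>s. (Re (g s))\<^sup>2) \<le> 0"
    using field_le_epsilon[of "integral {0..1} (\<lambda>s. (Re (g s))\<^sup>2)" 0] by auto
  moreover have "integral {0..1} (\<lambda>s. (Re (g s))\<^sup>2) \<ge> 0"
    by (intro integral_nonneg integrable_continuous_real continuous_intros contR) auto
  moreover have "(\<lambda>s. (Re (g s))\<^sup>2) integrable_on {0..1}"
    by (intro integrable_continuous_real continuous_intros contR)
  ultimately have "((\<lambda>s. (Re (g s))\<^sup>2) has_integral 0) (cbox 0 1)"
    by (metis antisym cbox_interval integrable_integral)
  then have "(Re (g s))\<^sup>2 = 0"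
    by (rule has_integral_0_cbox_imp_0[rotated 2])
      (use s in \<open>auto intro!: continuous_intros contR\<close>)
  then show ?thesis by simp
qed

text \<open>The imaginary part of \<open>g\<close> is, up to sign, the real part of
  \<open>\<i> * g\<close>, which satisfies the same hypotheses.\<close>

lemma zero_if_fourier_zero:
  fixes g :: "real \<Rightarrow> complex"
  assumes "continuous_on UNIV g" "g 1 = g 0"
    and "\<And>n. integral {0..1} (\<lambda>s. fourier_char n s * g s) = 0"
    and "s \<in> {0..1}"
  shows "g s = 0"
proof -
  have "integral {0..1} (\<lambda>s. fourier_char n s * (\<i> * g s)) = \<i> * integral {0..1} (\<lambda>s. fourier_char n s * g s)" for n
    unfolding integral_mult_right[symmetric] by (simp add: mult_ac)
  then have "Re (\<i> * g s) = 0"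
    by (intro Re_zero_if_fourier_zero[of "\<lambda>s. \<i> * g s"])
      (use assms in \<open>auto intro: continuous_intros\<close>)
  with Re_zero_if_fourier_zero[OF assms] show ?thesis by (simp add: complex_eq_iff)
qed

section \<open>Left-invariant fields tangent to a torus\<close>

lemma homeomorphism_inv_into_chart:
  assumes "homeomorphism U (c ` U) c (inv_into U c)"
  shows "inj_on c U" "continuous_on U c" "continuous_on (c ` U) (inv_into U c)"
  using assms unfolding homeomorphism_def by (auto intro: inj_on_inverseI)

section \<open>Smooth functions on the group, read in charts\<close>

context
  fixes G :: "('g::{t2_space,second_countable_topology}, 'e::euclidean_space) lie_data"
  assumes lie: "lie_group G"
begin

interpretation group G using lie by (simp add: lie_group_def)

lemma carrier_UNIV [simp]: "carrier G = UNIV"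
  using lie by (simp add: lie_group_def)

lemma
  assumes "(U, c) \<in> atlas G"
  shows chart_open: "open U" and chart_open_image: "open (c ` U)" and chart_inj: "inj_on c U"
    and chart_continuous: "continuous_on U c"
    and chart_inv_continuous: "continuous_on (c ` U) (inv_into U c)"
proof -
  have "open U \<and> open (c ` U) \<and> homeomorphism U (c ` U) c (inv_into U c)"
    using lie assms by (fastforce simp: lie_group_def smooth_atlas_def)
  then show "open U" "open (c ` U)" "inj_on c U" "continuous_on U c" "continuous_on (c ` U) (inv_into U c)"
    using homeomorphism_inv_into_chart by auto
qed

lemma chart_at: obtains U c where "(U, c) \<in> atlas G" "x \<in> U"
proof -
  have "x \<in> (\<Union>(U, c)\<in>atlas G. U)"
    using lie unfolding lie_group_def smooth_atlas_def by simp
  then show thesis using that by blast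
qed

text \<open>The condition in charts with \<open>k = 0\<close> already yields continuity on the
  group, so afterwards only the chart expressions have to be checked.\<close>

lemma smooth_functions_iff:
  "f \<in> smooth_functions G \<longleftrightarrow> (\<forall>(U, c)\<in>atlas G. \<forall>k. Ck_on k (c ` U) (\<lambda>p. f (inv_into U c p)))"
proof
  assume "f \<in> smooth_functions G"
  then show "\<forall>(U, c)\<in>atlas G. \<forall>k. Ck_on k (c ` U) (\<lambda>p. f (inv_into U c p))"
    by (auto simp: smooth_functions_def smooth_map_def euclidean_atlas_def smooth_on_def o_def)
next
  assume *: "\<forall>(U, c)\<in>atlas G. \<forall>k. Ck_on k (c ` U) (\<lambda>p. f (inv_into U c p))"
  have "isCont f x" for x
  proof -
    obtain U c where U: "(U, c) \<in> atlas G" "x \<in> U" by (rule chart_at)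
    have "Ck_on 0 (c ` U) (\<lambda>p. f (inv_into U c p))" using * U(1) by blast
    then have "continuous_on U (\<lambda>x. f (inv_into U c (c x)))"
      using chart_continuous[OF U(1)] by (auto intro: continuous_on_compose2)
    then have "continuous_on U f"
      by (rule continuous_on_eq) (use chart_inj[OF U(1)] in auto)
    then show ?thesis using chart_open[OF U(1)] U(2) continuous_on_eq_continuous_at by blast
  qed
  then show "f \<in> smooth_functions G"
    using * by (auto simp: smooth_functions_def smooth_map_def euclidean_atlas_def smooth_on_def o_def
        intro: continuous_at_imp_continuous_on)
qed

lemma smooth_functionsD:
  "f \<in> smooth_functions G \<Longrightarrow> (U, c) \<in> atlas G \<Longrightarrow> Ck_on k (c ` U) (\<lambda>p. f (inv_into U c p))"
  by (auto simp: smooth_functions_iff)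

lemma smooth_functions_add:
  assumes "f \<in> smooth_functions G" "h \<in> smooth_functions G"
  shows "f + h \<in> smooth_functions G"
  using assms by (auto simp: smooth_functions_iff intro!: Ck_on_add chart_open_image)

lemma smooth_functions_mult:
  assumes "f \<in> smooth_functions G" "h \<in> smooth_functions G"
  shows "f * h \<in> smooth_functions G"
  using assms by (auto simp: smooth_functions_iff
      intro!: Ck_on_bounded_bilinear[OF bounded_bilinear_mult] chart_open_image)

lemma smooth_functions_const: "(\<lambda>x. a) \<in> smooth_functions G"
  by (auto simp: smooth_functions_iff intro!: Ck_on_const)

lemma smooth_functions_scale:
  assumes "f \<in> smooth_functions G" shows "(\<lambda>x. a * f x) \<in> smooth_functions G"
  using smooth_functions_mult[OF smooth_functions_const[of a] assms] by (simp add: func_times)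

lemma mult_continuous: "continuous_on UNIV (\<lambda>(x, y). x \<otimes>\<^bsub>G\<^esub> y)"
  using lie by (simp add: lie_group_def smooth_map_def)

text \<open>\<open>smooth_map\<close> describes the product only where it lands in a single chart,
  so the claim is proved locally: a chart \<open>W\<close> around the value of the product is
  inserted between the multiplication and \<open>f\<close>.\<close>

lemma Ck_on_mult:
  assumes f: "f \<in> smooth_functions G" and U: "(U, c) \<in> atlas G" and V: "(V, c') \<in> atlas G"
  shows "Ck_on k (c ` U \<times> c' ` V) (\<lambda>(p, q). f (inv_into U c p \<otimes>\<^bsub>G\<^esub> inv_into V c' q))"
proof (rule Ck_on_local)
  fix pq assume pq: "pq \<in> c ` U \<times> c' ` V"
  define m where "m = (\<lambda>(x, y). x \<otimes>\<^bsub>G\<^esub> y)"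
  define i where "i = map_prod (inv_into U c) (inv_into V c')"
  have i: "inv_into (U \<times> V) (map_prod c c') z = i z" if "z \<in> c ` U \<times> c' ` V" for z
    using that chart_inj[OF U] chart_inj[OF V]
    by (auto simp: i_def inj_on_def intro!: inv_into_f_eq map_prod_inj_on)
  obtain W d where W: "(W, d) \<in> atlas G" "m (i pq) \<in> W" by (rule chart_at)
  define D where "D = (U \<times> V) \<inter> m -` W"
  have "open D"
    unfolding D_def m_def by (intro open_Int open_Times chart_open[OF U] chart_open[OF V]
        open_vimage[OF chart_open[OF W(1)] mult_continuous])
  \<comment> \<open>Writing the domain as a preimage under the continuous inverse charts shows that
    it is open.\<close>
  have img: "map_prod c c' ` D = i -` D \<inter> c ` U \<times> c' ` V"
    using chart_inj[OF U] chart_inj[OF V] by (force simp: D_def i_def)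
  have "continuous_on (c ` U \<times> c' ` V) i"
    unfolding i_def map_prod_def split_beta
    by (intro continuous_on_Pair continuous_on_compose2[OF chart_inv_continuous[OF U]]
        continuous_on_compose2[OF chart_inv_continuous[OF V]] continuous_intros) auto
  then have op: "open (map_prod c c' ` D)"
    unfolding img using \<open>open D\<close> chart_open_image[OF U] chart_open_image[OF V]
    by (simp add: continuous_on_open_vimage open_Times)
  have prod: "(U \<times> V, map_prod c c') \<in> product_atlas (atlas G) (atlas G)"
    using U V by (auto simp: product_atlas_def)
  have "Ck_on k (map_prod c c' ` D) (d \<circ> m \<circ> inv_into (U \<times> V) (map_prod c c'))"
    using lie prod W(1) unfolding lie_group_def smooth_map_def smooth_on_def D_def m_def by blast
  then have "Ck_on k (map_prod c c' ` D) (\<lambda>z. d (m (i z)))"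
    by (rule Ck_on_cong[OF op, rotated]) (use i img in auto)
  then have "Ck_on k (map_prod c c' ` D) (\<lambda>z. f (inv_into W d (d (m (i z)))))"
    by (rule Ck_on_compose[OF op chart_open_image[OF W(1)] _ smooth_functionsD[OF f W(1)]])
      (use chart_inj[OF U] chart_inj[OF V] in \<open>auto simp: img D_def i_def\<close>)
  then have "Ck_on k (map_prod c c' ` D) (\<lambda>(p, q). f (inv_into U c p \<otimes>\<^bsub>G\<^esub> inv_into V c' q))"
    by (rule Ck_on_cong[OF op, rotated]) (use chart_inj[OF W(1)] chart_inj[OF U] chart_inj[OF V] in \<open>auto simp: img D_def m_def i_def\<close>)
  moreover have "pq \<in> map_prod c c' ` D"
    using pq W(2) chart_inj[OF U] chart_inj[OF V] by (auto simp: img D_def i_def inv_into_into)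
  ultimately show "\<exists>S. open S \<and> pq \<in> S \<and>
      Ck_on k S (\<lambda>(p, q). f (inv_into U c p \<otimes>\<^bsub>G\<^esub> inv_into V c' q))"
    using op by blast
qed

lemma smooth_functions_left_translate:
  assumes f: "f \<in> smooth_functions G"
  shows "(\<lambda>x. f (a \<otimes>\<^bsub>G\<^esub> x)) \<in> smooth_functions G"
  unfolding smooth_functions_iff
proof safe
  fix V c' k assume V: "(V, c') \<in> atlas G"
  obtain U c where U: "(U, c) \<in> atlas G" "a \<in> U" by (rule chart_at)
  have "Ck_on k (c' ` V) (\<lambda>q. case (c a, q) of (p, q) \<Rightarrow> f (inv_into U c p \<otimes>\<^bsub>G\<^esub> inv_into V c' q))"
    by (rule Ck_on_compose[OF chart_open_image[OF V] open_Times[OF chart_open_image[OF U(1)] chart_open_image[OF V]]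
          Ck_on_Pair[OF chart_open_image[OF V] Ck_on_const Ck_on_bounded_linear[OF bounded_linear_ident]]
          Ck_on_mult[OF f U(1) V]])
      (use U in auto)
  then show "Ck_on k (c' ` V) (\<lambda>p. f (a \<otimes>\<^bsub>G\<^esub> inv_into V c' p))"
    using U chart_inj[OF U(1)] by simp
qed

lemma lie_algebra_zero:
  assumes "X \<in> lie_algebra G" shows "X 0 = 0"
proof -
  have "\<forall>a. \<forall>f\<in>smooth_functions G. X (\<lambda>x. a * f x) = (\<lambda>x. a * X f x)"
    using assms by (simp add: lie_algebra_def)
  from bspec[OF spec[OF this, of 0] smooth_functions_const[of 0]] show ?thesis by (simp add: func_zero)
qed

section \<open>Derivatives along a homomorphism from a Euclidean space into the group\<close>

context
  fixes \<phi> :: "'b::euclidean_space \<Rightarrow> 'g"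
  assumes smooth: "smooth_map euclidean_atlas (atlas G) \<phi>"
    and hom: "\<phi> (u + w) = \<phi> u \<otimes>\<^bsub>G\<^esub> \<phi> w"
begin

lemma phi_zero: "\<phi> 0 = \<one>\<^bsub>G\<^esub>"
  using hom[of 0 0] by (metis add_0 carrier_UNIV UNIV_I l_cancel_one)

lemma phi_continuous: "continuous_on UNIV \<phi>"
  using smooth by (simp add: smooth_map_def)

lemma phi_Ck_on: "(V, c') \<in> atlas G \<Longrightarrow> Ck_on k (\<phi> -` V) (\<lambda>w. c' (\<phi> w))"
  using smooth by (auto simp: smooth_map_def euclidean_atlas_def smooth_on_def o_def
      inv_into_def[of UNIV id] split: prod.splits)

text \<open>Joint regularity in the base point and the translation parameter is the source of the
  smoothness both of derivatives along \<phi> and of integrals over its orbits.\<close>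

lemma Ck_on_translate:
  assumes f: "f \<in> smooth_functions G" and U: "(U, c) \<in> atlas G"
  shows "Ck_on k (c ` U \<times> UNIV) (\<lambda>(p, w). f (inv_into U c p \<otimes>\<^bsub>G\<^esub> \<phi> w))"
proof (rule Ck_on_local)
  fix pw assume pw: "pw \<in> c ` U \<times> (UNIV :: 'b set)"
  obtain V c' where V: "(V, c') \<in> atlas G" "\<phi> (snd pw) \<in> V" by (rule chart_at)
  define S where "S = c ` U \<times> \<phi> -` V"
  have O: "open (\<phi> -` V)" by (rule open_vimage[OF chart_open[OF V(1)] phi_continuous])
  have S: "open S" unfolding S_def by (intro open_Times O chart_open_image[OF U])
  have "Ck_on k S (\<lambda>z. c' (\<phi> (snd z)))"
    by (rule Ck_on_compose[OF S O Ck_on_bounded_linear[OF bounded_linear_snd] phi_Ck_on[OF V(1)]])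
      (auto simp: S_def)
  then have "Ck_on k S (\<lambda>z. (fst z, c' (\<phi> (snd z))))"
    by (rule Ck_on_Pair[OF S Ck_on_bounded_linear[OF bounded_linear_fst]])
  then have "Ck_on k S (\<lambda>z. case (fst z, c' (\<phi> (snd z))) of (p, q) \<Rightarrow>
      f (inv_into U c p \<otimes>\<^bsub>G\<^esub> inv_into V c' q))"
    by (rule Ck_on_compose[OF S open_Times[OF chart_open_image[OF U] chart_open_image[OF V(1)]] _
          Ck_on_mult[OF f U V(1)]]) (auto simp: S_def)
  then have "Ck_on k S (\<lambda>(p, w). f (inv_into U c p \<otimes>\<^bsub>G\<^esub> \<phi> w))"
    by (rule Ck_on_cong[OF S, rotated]) (use chart_inj[OF V(1)] in \<open>auto simp: S_def\<close>)
  then show "\<exists>S. open S \<and> pw \<in> S \<and> Ck_on k S (\<lambda>(p, w). f (inv_into U c p \<otimes>\<^bsub>G\<^esub> \<phi> w))"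
    using S pw V by (intro exI[of _ S]) (auto simp: S_def)
qed

text \<open>Taking the total derivative at 0 and evaluating it at \<open>u\<close>, rather than
  differentiating along one line, makes linearity in \<open>u\<close> immediate. The value 0 on
  other functions matches the normalisation in \<open>lie_algebra\<close>.\<close>

definition translation_field :: "'b \<Rightarrow> 'g vfield" where
  "translation_field u = (\<lambda>f x. if f \<in> smooth_functions G
     then frechet_derivative (\<lambda>w. f (x \<otimes>\<^bsub>G\<^esub> \<phi> w)) (at 0) u else 0)"

text \<open>In a chart, the derivative along \<phi> is a partial derivative of a function of both
  variables. This form also shows how it depends on the base point.\<close>

lemma translate_has_derivative:
  assumes f: "f \<in> smooth_functions G" and U: "(U, c) \<in> atlas G" "x \<in> U"
  defines "F \<equiv> \<lambda>(p, w). f (inv_into U c p \<otimes>\<^bsub>G\<^esub> \<phi> w)"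
  shows "((\<lambda>w. f (x \<otimes>\<^bsub>G\<^esub> \<phi> w)) has_derivative (\<lambda>v. frechet_derivative F (at (c x, w)) (0, v))) (at w)"
proof -
  have "Ck_on 1 (c ` U \<times> UNIV) F" unfolding F_def by (rule Ck_on_translate[OF f U(1)])
  then have F: "(F has_derivative frechet_derivative F (at (c x, w))) (at (c x, w))"
    using U(2) by (auto simp: frechet_derivative_works)
  have "((\<lambda>w. (c x, w)) has_derivative (\<lambda>v. (0, v))) (at w)"
    by (auto intro!: derivative_eq_intros)
  from has_derivative_compose[OF this F] show ?thesis
    using U chart_inj[OF U(1)] by (simp add: F_def)
qed

lemma translate_differentiable:
  assumes "f \<in> smooth_functions G"
  shows "(\<lambda>w. f (x \<otimes>\<^bsub>G\<^esub> \<phi> w)) differentiable (at w)"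
proof -
  obtain U c where "(U, c) \<in> atlas G" "x \<in> U" by (rule chart_at)
  from differentiableI[OF translate_has_derivative[OF assms this]] show ?thesis .
qed

lemma translation_field_add: "translation_field (u + w) = translation_field u + translation_field w"
  using translate_differentiable
  by (auto simp: translation_field_def fun_eq_iff linear_add linear_frechet_derivative)

lemma translation_field_scale: "translation_field (a *\<^sub>R u) = cscale (of_real a) (translation_field u)"
  using translate_differentiable
  by (auto simp: translation_field_def cscale_def fun_eq_iff linear_scale linear_frechet_derivative
      scaleR_conv_of_real)

text \<open>The homomorphism law moves the base point along the orbit and so reduces the derivative
  at \<open>s\<close> to a derivative at 0.\<close>

lemma orbit_has_derivative:
  assumes f: "f \<in> smooth_functions G"
  shows "((\<lambda>s. f (x \<otimes>\<^bsub>G\<^esub> \<phi> (s *\<^sub>R u))) has_vector_derivative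
    translation_field u f (x \<otimes>\<^bsub>G\<^esub> \<phi> (s *\<^sub>R u))) (at s)"
proof -
  define y where "y = x \<otimes>\<^bsub>G\<^esub> \<phi> (s *\<^sub>R u)"
  have l: "((\<lambda>r. (r - s) *\<^sub>R u) has_derivative (\<lambda>r. r *\<^sub>R u)) (at s)"
    by (auto intro!: derivative_eq_intros)
  have D: "((\<lambda>w. f (y \<otimes>\<^bsub>G\<^esub> \<phi> w)) has_derivative frechet_derivative (\<lambda>w. f (y \<otimes>\<^bsub>G\<^esub> \<phi> w)) (at 0))
      (at ((s - s) *\<^sub>R u))"
    using translate_differentiable[OF f] by (simp add: frechet_derivative_works)
  have "f (y \<otimes>\<^bsub>G\<^esub> \<phi> ((r - s) *\<^sub>R u)) = f (x \<otimes>\<^bsub>G\<^esub> \<phi> (r *\<^sub>R u))" for r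
    by (simp add: y_def m_assoc hom[symmetric] algebra_simps)
  then show ?thesis
    using has_derivative_compose[OF l D] f
    by (simp add: has_vector_derivative_def translation_field_def y_def[symmetric]
        linear_scale[OF linear_frechet_derivative[OF translate_differentiable[OF f]]])
qed

lemma translation_field_has_derivative:
  assumes f: "f \<in> smooth_functions G"
  shows "((\<lambda>s. f (x \<otimes>\<^bsub>G\<^esub> \<phi> (s *\<^sub>R u))) has_vector_derivative translation_field u f x) (at 0)"
  using orbit_has_derivative[OF f, of x u 0] by (simp add: phi_zero)

lemma translation_field_eqI:
  "f \<in> smooth_functions G \<Longrightarrow> ((\<lambda>s. f (x \<otimes>\<^bsub>G\<^esub> \<phi> (s *\<^sub>R u))) has_vector_derivative D) (at 0) \<Longrightarrow>
    translation_field u f x = D"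
  using translation_field_has_derivative vector_derivative_unique_at by blast

lemma translation_field_smooth:
  assumes f: "f \<in> smooth_functions G"
  shows "translation_field u f \<in> smooth_functions G"
  unfolding smooth_functions_iff
proof safe
  fix U c k assume U: "(U, c) \<in> atlas G"
  define F where "F = (\<lambda>(p, w). f (inv_into U c p \<otimes>\<^bsub>G\<^esub> \<phi> w))"
  \<comment> \<open>One order of differentiability is spent on forming the derivative.\<close>
  have "Ck_on (Suc k) (c ` U \<times> UNIV) F" unfolding F_def by (rule Ck_on_translate[OF f U])
  then have F: "Ck_on k (c ` U \<times> UNIV) (\<lambda>z. frechet_derivative F (at z) (0, u))" by simp
  have op: "open (c ` U)" by (rule chart_open_image[OF U])
  have ck: "Ck_on k (c ` U) (\<lambda>p. frechet_derivative F (at (p, 0)) (0, u))"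
    by (rule Ck_on_compose[OF op open_Times[OF op open_UNIV] Ck_on_Pair[OF op
            Ck_on_bounded_linear[OF bounded_linear_ident] Ck_on_const] F]) auto
  show "Ck_on k (c ` U) (\<lambda>p. translation_field u f (inv_into U c p))"
  proof (rule Ck_on_cong[OF op _ ck])
    fix p assume "p \<in> c ` U"
    then obtain x where x: "x \<in> U" "p = c x" by auto
    have "((\<lambda>w. f (x \<otimes>\<^bsub>G\<^esub> \<phi> w)) has_derivative (\<lambda>v. frechet_derivative F (at (c x, 0)) (0, v))) (at 0)"
      unfolding F_def by (rule translate_has_derivative[OF f U x(1)])
    from fun_cong[OF frechet_derivative_at[OF this], of u]
    show "frechet_derivative F (at (p, 0)) (0, u) = translation_field u f (inv_into U c p)"
      using x chart_inj[OF U] f by (simp add: translation_field_def)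
  qed
qed

lemma translation_field_scale_fun:
  assumes f: "f \<in> smooth_functions G"
  shows "translation_field u (\<lambda>x. a * f x) = (\<lambda>x. a * translation_field u f x)"
  by (rule ext, rule translation_field_eqI[OF smooth_functions_scale[OF f]])
    (intro has_vector_derivative_mult_right translation_field_has_derivative f)

lemma translation_field_in_lie_algebra: "translation_field u \<in> lie_algebra G"
  unfolding lie_algebra_def
proof (intro CollectI conjI allI impI ballI)
  fix f h assume f: "f \<in> smooth_functions G" and h: "h \<in> smooth_functions G"
  show "translation_field u (f + h) = translation_field u f + translation_field u h"
    by (rule ext, rule translation_field_eqI[OF smooth_functions_add[OF f h]])
      (auto intro!: has_vector_derivative_add translation_field_has_derivative f h)
  show "translation_field u (f * h) = translation_field u f * h + f * translation_field u h"
  proof (rule ext, rule translation_field_eqI[OF smooth_functions_mult[OF f h]])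
    fix x
    show "((\<lambda>s. (f * h) (x \<otimes>\<^bsub>G\<^esub> \<phi> (s *\<^sub>R u))) has_vector_derivative
      (translation_field u f * h + f * translation_field u h) x) (at 0)"
      using has_vector_derivative_mult[OF translation_field_has_derivative[OF f, of x u]
        translation_field_has_derivative[OF h, of x u]] by (simp add: phi_zero add.commute)
  qed
next
  fix f x assume f: "f \<in> smooth_functions G" and real: "\<forall>x. f x \<in> \<real>"
  have "((\<lambda>s. Im (f (x \<otimes>\<^bsub>G\<^esub> \<phi> (s *\<^sub>R u)))) has_vector_derivative Im (translation_field u f x)) (at 0)"
    by (rule bounded_linear.has_vector_derivative[OF bounded_linear_Im translation_field_has_derivative[OF f]])
  moreover have "Im (f y) = 0" for y using real by (simp add: complex_is_Real_iff)
  ultimately have "Im (translation_field u f x) = 0"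
    using vector_derivative_unique_at[OF _ has_vector_derivative_const] by fastforce
  then show "translation_field u f x \<in> \<real>" by (simp add: complex_is_Real_iff)
next
  fix a f assume f: "f \<in> smooth_functions G"
  show "translation_field u (\<lambda>x. f (a \<otimes>\<^bsub>G\<^esub> x)) = (\<lambda>x. translation_field u f (a \<otimes>\<^bsub>G\<^esub> x))"
    by (rule ext, rule translation_field_eqI[OF smooth_functions_left_translate[OF f]])
      (use translation_field_has_derivative[OF f] in \<open>simp add: m_assoc[symmetric]\<close>)
qed (auto simp: translation_field_smooth translation_field_scale_fun, simp add: translation_field_def func_zero)


section \<open>Solving the equation H h = \<mu> h + f along closed orbits\<close>

definition twisted_average :: "'b \<Rightarrow> complex \<Rightarrow> ('g \<Rightarrow> complex) \<Rightarrow> 'g \<Rightarrow> complex" where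
  "twisted_average u \<mu> f x = integral {0..1} (\<lambda>r. exp (of_real r * - \<mu>) * f (x \<otimes>\<^bsub>G\<^esub> \<phi> (r *\<^sub>R u)))"

lemma twisted_average_smooth:
  assumes f: "f \<in> smooth_functions G"
  shows "twisted_average u \<mu> f \<in> smooth_functions G"
  unfolding smooth_functions_iff
proof safe
  fix U c k assume U: "(U, c) \<in> atlas G"
  define F where "F = (\<lambda>(p, w). f (inv_into U c p \<otimes>\<^bsub>G\<^esub> \<phi> w))"
  have op: "open (c ` U)" by (rule chart_open_image[OF U])
  have op1: "open (c ` U \<times> (UNIV :: real set))" and op2: "open (c ` U \<times> (UNIV :: 'b set))"
    using op by (auto intro: open_Times)
  have F: "Ck_on k (c ` U \<times> UNIV) F" unfolding F_def by (rule Ck_on_translate[OF f U])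
  have "Ck_on k (c ` U \<times> UNIV) (\<lambda>z. (fst z, snd z *\<^sub>R u))"
    by (rule Ck_on_Pair[OF op1 Ck_on_bounded_linear[OF bounded_linear_fst] Ck_on_bounded_linear[OF
          bounded_linear_compose[OF bounded_linear_scaleR_left bounded_linear_snd]]])
  then have Fu: "Ck_on k (c ` U \<times> UNIV) (\<lambda>z. F (fst z, snd z *\<^sub>R u))"
    by (rule Ck_on_compose[OF op1 op2 _ F]) auto
  have "Ck_on k (c ` U \<times> UNIV) (\<lambda>z. exp (of_real (snd z) * - \<mu>))"
    by (rule Ck_on_compose[OF op1 open_UNIV Ck_on_bounded_linear[OF bounded_linear_snd] Ck_on_exp_linear]) auto
  then have "Ck_on k (c ` U \<times> UNIV) (\<lambda>z. exp (of_real (snd z) * - \<mu>) * F (fst z, snd z *\<^sub>R u))"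
    by (rule Ck_on_bounded_bilinear[OF bounded_bilinear_mult op1 _ Fu])
  from Ck_on_parametric_integral[OF op this, of 0 1]
  show "Ck_on k (c ` U) (\<lambda>p. twisted_average u \<mu> f (inv_into U c p))"
    by (simp add: F_def twisted_average_def)
qed

text \<open>Moving \<open>x\<close> by \<open>t\<close> along the orbit turns the average into
  \<open>exp (of_real t * \<mu>)\<close> times an integral over [t, t + 1]. At t = 0 the exponential
  contributes \<mu> times the average, and the endpoints contribute a boundary term, in which both
  values of \<open>f\<close> agree because \<open>u\<close> is mapped to the unit.\<close>

lemma translation_field_twisted_average:
  assumes f: "f \<in> smooth_functions G" and u: "\<phi> u = \<one>\<^bsub>G\<^esub>"
  shows "translation_field u (twisted_average u \<mu> f) x =
    \<mu> * twisted_average u \<mu> f x + (exp (- \<mu>) - 1) * f x"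
proof -
  define g where "g s = f (x \<otimes>\<^bsub>G\<^esub> \<phi> (s *\<^sub>R u))" for s :: real
  define q where "q s = exp (of_real s * - \<mu>) * g s" for s :: real
  have "continuous_on UNIV g"
    unfolding g_def using orbit_has_derivative[OF f, of x u]
    by (intro continuous_at_imp_continuous_on ballI) (blast intro: has_vector_derivative_continuous)
  \<comment> \<open>A compact interval that contains [t, t + 1] in its interior for every t strictly
    between -1 and 1.\<close>
  then have "continuous_on {-1..3} q"
    unfolding q_def by (intro continuous_intros) (auto intro: continuous_on_subset)
  from antiderivative_continuous[OF this] obtain P where
    P': "\<And>s. s \<in> {-1..3} \<Longrightarrow> (P has_vector_derivative q s) (at s within {-1..3})" by blast
  have P: "(P has_vector_derivative q s) (at s)" if "s \<in> {-1<..<3}" for s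
    using P'[of s] that by (simp add: at_within_Icc_at)
  have avg: "exp (of_real t * \<mu>) * (P (t + 1) - P t) = twisted_average u \<mu> f (x \<otimes>\<^bsub>G\<^esub> \<phi> (t *\<^sub>R u))"
    if t: "t \<in> {-1<..<1}" for t
  proof -
    have "((\<lambda>r. exp (of_real t * \<mu>) * P (t + r)) has_vector_derivative
        exp (of_real r * - \<mu>) * f (x \<otimes>\<^bsub>G\<^esub> \<phi> (t *\<^sub>R u) \<otimes>\<^bsub>G\<^esub> \<phi> (r *\<^sub>R u))) (at r within {0..1})"
      if r: "r \<in> {0..1}" for r
    proof -
      have "((\<lambda>r. t + r) has_vector_derivative 1) (at r within {0..1})"
        by (auto intro!: derivative_eq_intros)
      moreover have "(P has_vector_derivative q (t + r)) (at (t + r) within (\<lambda>r. t + r) ` {0..1})"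
        by (rule has_vector_derivative_at_within[OF P]) (use r t in auto)
      ultimately have "(P \<circ> (\<lambda>r. t + r) has_vector_derivative 1 *\<^sub>R q (t + r)) (at r within {0..1})"
        by (rule vector_diff_chain_within)
      from has_vector_derivative_mult_right[OF this, of "exp (of_real t * \<mu>)"]
      have "((\<lambda>r. exp (of_real t * \<mu>) * P (t + r)) has_vector_derivative
          exp (of_real t * \<mu>) * q (t + r)) (at r within {0..1})" by (simp add: o_def)
      moreover have "exp (of_real t * \<mu>) * q (t + r) =
          exp (of_real r * - \<mu>) * f (x \<otimes>\<^bsub>G\<^esub> \<phi> (t *\<^sub>R u) \<otimes>\<^bsub>G\<^esub> \<phi> (r *\<^sub>R u))"
        by (simp add: q_def g_def m_assoc hom[symmetric] scaleR_add_left mult.assoc[symmetric]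
            exp_add[symmetric]) (simp add: algebra_simps)
      ultimately show ?thesis by simp
    qed
    from fundamental_theorem_of_calculus[OF _ this, THEN integral_unique]
    show ?thesis by (simp add: twisted_average_def algebra_simps)
  qed
  have P1: "((\<lambda>t. P (t + 1)) has_vector_derivative q 1) (at 0)"
  proof -
    have "((\<lambda>t. t + 1) has_vector_derivative 1) (at (0::real))"
      by (auto intro!: derivative_eq_intros)
    from vector_diff_chain_at[OF this, of P "q 1"] P[of 1] show ?thesis by (simp add: o_def)
  qed
  have e: "((\<lambda>t. exp (of_real t * \<mu>)) has_vector_derivative \<mu>) (at 0)"
    by (auto intro!: derivative_eq_intros has_vector_derivative_real_field simp: mult.commute)
  have "((\<lambda>t. exp (of_real t * \<mu>) * (P (t + 1) - P t)) has_vector_derivative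
      exp (of_real 0 * \<mu>) * (q 1 - q 0) + \<mu> * (P (0 + 1) - P 0)) (at 0)"
    by (rule has_vector_derivative_mult[OF e has_vector_derivative_diff[OF P1 P]]) simp
  then have "((\<lambda>t. twisted_average u \<mu> f (x \<otimes>\<^bsub>G\<^esub> \<phi> (t *\<^sub>R u))) has_vector_derivative
      exp (of_real 0 * \<mu>) * (q 1 - q 0) + \<mu> * (P (0 + 1) - P 0)) (at 0)"
    by (rule has_vector_derivative_transform_within_open[of _ _ _ "{-1<..<1}"]) (auto simp: avg)
  moreover have "P (0 + 1) - P 0 = twisted_average u \<mu> f x"
    using avg[of 0] by (simp add: phi_zero)
  moreover have "exp (of_real 0 * \<mu>) * (q 1 - q 0) = (exp (- \<mu>) - 1) * f x"
    by (simp add: q_def g_def u phi_zero algebra_simps)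
  ultimately show ?thesis
    using translation_field_eqI[OF twisted_average_smooth[OF f]] by (simp add: add.commute)
qed

text \<open>If \<open>exp \<theta> \<noteq> 1\<close>, then \<open>H - \<mu>\<close> with \<open>\<mu> = - 2 \<pi> i n - \<theta>\<close> is onto, so that \<open>X f = (H + 2 \<pi> i n) k\<close>
  for some smooth \<open>k\<close>, and such a function has no Fourier coefficient at \<open>- n\<close>.\<close>

lemma eigenvalue_integral:
  assumes u: "\<phi> u = \<one>\<^bsub>G\<^esub>"
    and smooth: "\<And>f. f \<in> smooth_functions G \<Longrightarrow> X f \<in> smooth_functions G"
    and add: "\<And>f h. f \<in> smooth_functions G \<Longrightarrow> h \<in> smooth_functions G \<Longrightarrow> X (f + h) = X f + X h"
    and scale: "\<And>a f. f \<in> smooth_functions G \<Longrightarrow> X (\<lambda>x. a * f x) = (\<lambda>x. a * X f x)"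
    and off: "\<And>f. f \<notin> smooth_functions G \<Longrightarrow> X f = 0"
    and eigen: "lie_bracket (translation_field u) X = cscale \<theta> X" and "X \<noteq> 0"
  shows "exp \<theta> = 1"
proof (rule ccontr)
  assume \<theta>: "exp \<theta> \<noteq> 1"
  have "X f x = 0" if f: "f \<in> smooth_functions G" for f x
  proof -
    define g where "g s = X f (x \<otimes>\<^bsub>G\<^esub> \<phi> (s *\<^sub>R u))" for s :: real
    have "continuous_on UNIV g"
      unfolding g_def using orbit_has_derivative[OF smooth[OF f], of x u]
      by (intro continuous_at_imp_continuous_on ballI) (blast intro: has_vector_derivative_continuous)
    moreover have "integral {0..1} (\<lambda>s. fourier_char n s * g s) = 0" for n
    proof -
      define \<nu> where "\<nu> = 2 * of_int n * pi * \<i>"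
      \<comment> \<open>With f = H h - \<mu> h the bracket relation gives X f = H (X h) - (\<theta>
        + \<mu>) X h, and this choice of \<mu> turns the last coefficient into \<nu>.\<close>
      define \<mu> where "\<mu> = - \<nu> - \<theta>"
      have e\<nu>: "exp \<nu> = 1" unfolding \<nu>_def exp_eq_1 by (auto intro!: exI[of _ n])
      define \<kappa> where "\<kappa> = exp (- \<mu>) - 1"
      \<comment> \<open>Since exp \<nu> = 1, the number exp (- \<mu>) equals exp \<theta>, which was
        assumed to differ from 1.\<close>
      have "\<kappa> \<noteq> 0" using \<theta> e\<nu> by (simp add: \<kappa>_def \<mu>_def exp_add)
      define h where "h = (\<lambda>x. inverse \<kappa> * twisted_average u \<mu> f x)"
      have h: "h \<in> smooth_functions G"
        unfolding h_def by (intro smooth_functions_scale twisted_average_smooth f)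
      have Hh: "translation_field u h = (\<lambda>x. \<mu> * h x + f x)"
        unfolding h_def translation_field_scale_fun[OF twisted_average_smooth[OF f]]
          translation_field_twisted_average[OF f u] \<kappa>_def[symmetric]
        using \<open>\<kappa> \<noteq> 0\<close> by (auto simp: fun_eq_iff field_simps)
      then have "f = translation_field u h + (\<lambda>x. - \<mu> * h x)" by (auto simp: fun_eq_iff)
      then have "X f = X (translation_field u h) + X (\<lambda>x. - \<mu> * h x)"
        using add[OF translation_field_smooth[OF h] smooth_functions_scale[OF h]] by metis
      then have "X f y = X (translation_field u h) y - \<mu> * X h y" for y
        using scale[OF h, of "- \<mu>"] by simp
      moreover have "translation_field u (X h) y - X (translation_field u h) y = \<theta> * X h y" for y
        using fun_cong[OF fun_cong[OF eigen, of h], of y] by (simp add: lie_bracket_def cscale_def)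
      ultimately have Xf: "X f y = translation_field u (X h) y + \<nu> * X h y" for y
        by (simp add: \<mu>_def algebra_simps diff_eq_eq eq_diff_eq)
      define k where "k s = X h (x \<otimes>\<^bsub>G\<^esub> \<phi> (s *\<^sub>R u))" for s :: real
      have char: "(fourier_char n has_vector_derivative \<nu> * fourier_char n s) (at s)" for s
        unfolding fourier_char_def \<nu>_def[symmetric]
        by (auto intro!: derivative_eq_intros has_vector_derivative_real_field simp: mult.commute)
      \<comment> \<open>By the formula for \<open>X f\<close>, the integrand is an exact derivative.
        The endpoint values agree because the orbit is closed and
        \<open>exp \<nu> = 1\<close>.\<close>
      have "((\<lambda>s. fourier_char n s * k s) has_vector_derivative fourier_char n s * g s) (at s)" for s
        using has_vector_derivative_mult[OF char orbit_has_derivative[OF smooth[OF h], of x u s]]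
        by (simp add: k_def g_def Xf algebra_simps)
      then have "((\<lambda>s. fourier_char n s * g s) has_integral (fourier_char n 1 * k 1 - fourier_char n 0 * k 0)) {0..1}"
        by (intro fundamental_theorem_of_calculus) (auto intro: has_vector_derivative_at_within)
      moreover have "fourier_char n 1 * k 1 - fourier_char n 0 * k 0 = 0"
        using e\<nu> by (simp add: fourier_char_def k_def u phi_zero \<nu>_def)
      ultimately show ?thesis by (simp add: integral_unique)
    qed
    moreover have "g 1 = g 0" by (simp add: g_def u phi_zero)
    ultimately have "g 0 = 0" by (intro zero_if_fourier_zero[of g]) auto
    then show ?thesis by (simp add: g_def phi_zero)
  qed
  then have "X f = 0" for f
    using off[of f] by (cases "f \<in> smooth_functions G") (auto simp: fun_eq_iff)
  then show False using \<open>X \<noteq> 0\<close> by (auto simp: fun_eq_iff)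
qed


text \<open>The curve \<open>\<phi> (s *\<^sub>R u)\<close> is a one-parameter subgroup with this
  velocity. The converse for a torus is \<open>subgroup_lie_algebra_torus\<close>.\<close>

lemma translation_field_in_subgroup_lie_algebra:
  assumes "range \<phi> \<subseteq> T"
  shows "translation_field u \<in> subgroup_lie_algebra G T"
proof -
  have bl: "bounded_linear (\<lambda>s. s *\<^sub>R u)" by (rule bounded_linear_scaleR_left)
  have "continuous_on UNIV (\<lambda>s. \<phi> (s *\<^sub>R u))"
    by (rule continuous_on_compose2[OF phi_continuous linear_continuous_on[OF bl]]) auto
  moreover have "Ck_on k ((\<lambda>s. \<phi> (s *\<^sub>R u)) -` V) (\<lambda>s. c' (\<phi> (s *\<^sub>R u)))" if V: "(V, c') \<in> atlas G" for k V c'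
    by (rule Ck_on_compose[OF _ _ Ck_on_bounded_linear[OF bl] phi_Ck_on[OF V]])
      (auto intro!: open_vimage[OF chart_open[OF V]] phi_continuous calculation)
  ultimately have "smooth_map euclidean_atlas (atlas G) (\<lambda>s. \<phi> (s *\<^sub>R u))"
    by (simp add: smooth_map_def euclidean_atlas_def smooth_on_def o_def split_beta inv_into_def[of UNIV id])
  then have "one_parameter_subgroup G (\<lambda>s. \<phi> (s *\<^sub>R u))"
    by (simp add: one_parameter_subgroup_def scaleR_add_left hom)
  then show ?thesis
    using translation_field_in_lie_algebra translation_field_has_derivative assms
    by (auto simp: subgroup_lie_algebra_def intro!: exI[of _ "\<lambda>s. \<phi> (s *\<^sub>R u)"])
qed

end

section \<open>The Lie algebra of a torus in coordinates, and the integrality of roots\<close>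

lemma coordinate_field_eq:
  assumes "torus_coordinates G T \<phi>"
  shows "coordinate_field G \<phi> j = translation_field \<phi> (axis j 1)"
proof -
  have 1: "smooth_map euclidean_atlas (atlas G) \<phi>" "\<And>u w. \<phi> (u + w) = \<phi> u \<otimes>\<^bsub>G\<^esub> \<phi> w"
    using assms by (auto simp: torus_coordinates_def)
  define e where "e = axis j (1::real)"
  have "axis j s = s *\<^sub>R e" for s by (simp add: e_def vec_eq_iff axis_def)
  then have "coordinate_field G \<phi> j f x = translation_field \<phi> e f x" for f x
    using vector_derivative_at[OF translation_field_has_derivative[OF 1, of f x e]]
    by (cases "f \<in> smooth_functions G") (simp add: coordinate_field_def, simp add: coordinate_field_def translation_field_def[OF 1])
  then show ?thesis by (auto simp: fun_eq_iff e_def)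
qed

text \<open>Near \<open>0\<close> the curve lifts to \<open>\<real>\<^sup>d\<close>, and the lift is locally additive because differences of small
  lifts that are integral vanish; no continuity of the lift is needed to read off its direction along the
  sequence \<open>\<delta> / (n + 1)\<close>.\<close>

lemma one_parameter_subgroup_in_torus:
  fixes \<phi> :: "real ^ 'd \<Rightarrow> 'g"
  assumes tc: "torus_coordinates G T \<phi>" and \<gamma>: "one_parameter_subgroup G \<gamma>" "range \<gamma> \<subseteq> T"
  obtains \<delta> u where "\<delta> > 0" "\<And>n. \<gamma> (\<delta> / real (Suc n)) = \<phi> ((\<delta> / real (Suc n)) *\<^sub>R u)"
proof -
  have hom: "\<phi> (u + w) = \<phi> u \<otimes>\<^bsub>G\<^esub> \<phi> w" and rng: "range \<phi> = T"
    and ker: "\<phi> u = \<one>\<^bsub>G\<^esub> \<longleftrightarrow> (\<forall>j. u $ j \<in> \<int>)" for u w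
    using tc by (auto simp: torus_coordinates_def)
  have cont: "continuous_on S \<phi>" for S
    using tc by (auto simp: torus_coordinates_def smooth_map_def intro: continuous_on_subset)
  have g_hom: "\<gamma> (s + r) = \<gamma> s \<otimes>\<^bsub>G\<^esub> \<gamma> r" for s r
    using \<gamma> by (simp add: one_parameter_subgroup_def)
  have g_cont: "continuous_on UNIV \<gamma>"
    using \<gamma> by (simp add: one_parameter_subgroup_def smooth_map_def)
  have g0: "\<gamma> 0 = \<one>\<^bsub>G\<^esub>" using g_hom[of 0 0] by (metis add_0 carrier_UNIV UNIV_I l_cancel_one)
  have same: "\<phi> u = \<phi> w \<longleftrightarrow> (\<forall>j. (u - w) $ j \<in> \<int>)" for u w
    using hom[of "u - w" w] ker[of "u - w"] by (metis diff_add_cancel carrier_UNIV UNIV_I r_cancel_one l_one)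
  \<comment> \<open>The part of the unit cube of representatives away from the origin. The only
    integral point of the cube is 0, so the compact image of \<open>K\<close> misses the unit, and
    \<gamma> avoids it for small times.\<close>
  define K where "K = cbox (\<chi> j. - 1/2) (\<chi> j. 1/2) \<inter> {u :: real ^ 'd. norm u \<ge> 1/4}"
  have "compact K"
    unfolding K_def by (intro compact_Int_closed compact_cbox closed_Collect_le continuous_intros)
  then have "closed (\<phi> ` K)"
    by (intro compact_imp_closed compact_continuous_image cont)
  moreover have "\<gamma> 0 \<notin> \<phi> ` K"
  proof
    assume "\<gamma> 0 \<in> \<phi> ` K"
    then obtain u where u: "u \<in> K" "\<forall>j. u $ j \<in> \<int>" using g0 ker by force
    have "u $ j = 0" for j
    proof -
      have "\<bar>u $ j\<bar> < 1" using u(1) by (auto simp: K_def mem_box_cart abs_less_iff dest!: spec[of _ j])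
      then show ?thesis using u(2) Ints_eq_abs_less1[of "u $ j" 0] by auto
    qed
    then have "u = 0" by (simp add: vec_eq_iff)
    then show False using u(1) by (simp add: K_def)
  qed
  ultimately have "open (\<gamma> -` (- \<phi> ` K))" "0 \<in> \<gamma> -` (- \<phi> ` K)"
    by (auto intro: open_vimage[OF open_Compl g_cont])
  then obtain \<epsilon> where \<epsilon>: "\<epsilon> > 0" "ball 0 \<epsilon> \<subseteq> \<gamma> -` (- \<phi> ` K)" by (meson openE)
  have "\<exists>w. norm w < 1/4 \<and> \<phi> w = \<gamma> s" if s: "\<bar>s\<bar> < \<epsilon>" for s
  proof -
    obtain u where u: "\<phi> u = \<gamma> s" using \<gamma>(2) rng by (metis UNIV_I image_iff subsetD)
    \<comment> \<open>Rounding moves a preimage into the cube; avoiding \<open>K\<close> then forces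
      its norm below 1/4.\<close>
    define w :: "real ^ 'd" where "w = (\<chi> j. u $ j - of_int (round (u $ j)))"
    have w: "\<phi> w = \<gamma> s" unfolding u[symmetric] same by (simp add: w_def)
    have "- 1/2 \<le> w $ j \<and> w $ j \<le> 1/2" for j
      using of_int_round_abs_le[of "u $ j"] unfolding w_def vec_lambda_beta by linarith
    then have "w \<in> cbox (\<chi> j. - 1/2) (\<chi> j. 1/2)" by (simp add: mem_box_cart)
    moreover have "w \<notin> K" using \<epsilon>(2) s w by (force simp: image_iff)
    ultimately show ?thesis using w by (auto simp: K_def not_le)
  qed
  then obtain w where w: "\<And>s. \<bar>s\<bar> < \<epsilon> \<Longrightarrow> norm (w s) < 1/4 \<and> \<phi> (w s) = \<gamma> s" by metis
  have add: "w (s + r) = w s + w r" if "\<bar>s\<bar> < \<epsilon>" "\<bar>r\<bar> < \<epsilon>" "\<bar>s + r\<bar> < \<epsilon>" for s r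
  proof -
    define z where "z = w (s + r) - (w s + w r)"
    have "\<phi> (w (s + r)) = \<phi> (w s + w r)" using w that by (simp add: hom g_hom)
    then have int: "z $ j \<in> \<int>" for j unfolding same z_def by blast
    \<comment> \<open>Three lifts of norm below 1/4 enter, and an integral vector of norm below 1 is
      0.\<close>
    have "norm z < 1"
      using w[OF that(1)] w[OF that(2)] w[OF that(3)] norm_triangle_ineq4[of "w (s + r)" "w s + w r"]
        norm_triangle_ineq[of "w s" "w r"] by (simp add: z_def)
    then have "\<bar>z $ j\<bar> < 1" for j using component_le_norm_cart[of z j] by linarith
    then have "z = 0" using int Ints_eq_abs_less1[of "z $ _" 0] by (auto simp: vec_eq_iff)
    then show ?thesis by (simp add: z_def)
  qed
  \<comment> \<open>Halving keeps \<delta>, and with it all the multiples of \<delta> / (n + 1) up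
    to \<delta>, strictly inside the range where \<open>w\<close> is controlled.\<close>
  define \<delta> where "\<delta> = \<epsilon> / 2"
  have \<delta>: "\<delta> > 0" using \<epsilon> by (simp add: \<delta>_def)
  have mult: "w (real (Suc k) * (\<delta> / real (Suc n))) = real (Suc k) *\<^sub>R w (\<delta> / real (Suc n))" if "k \<le> n" for k n
    using that
  proof (induction k)
    case (Suc k)
    define s where "s = \<delta> / real (Suc n)"
    have bd: "\<bar>real i * s\<bar> < \<epsilon>" if "i \<le> Suc n" for i
    proof -
      have "real i * s \<le> real (Suc n) * s" using that \<delta> by (intro mult_right_mono) (auto simp: s_def)
      moreover have "real (Suc n) * s = \<delta>" "real i * s \<ge> 0" using \<delta> by (simp_all add: s_def)
      ultimately show ?thesis using \<epsilon>(1) by (simp add: \<delta>_def)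
    qed
    have "w (real (Suc k) * s + s) = w (real (Suc k) * s) + w s"
      by (rule add) (use bd[of "Suc k"] bd[of 1] bd[of "Suc (Suc k)"] Suc.prems in \<open>auto simp: algebra_simps\<close>)
    moreover have "w (real (Suc k) * s) = real (Suc k) *\<^sub>R w s"
      using Suc unfolding s_def by simp
    moreover have "real (Suc (Suc k)) * s = real (Suc k) * s + s" by (simp add: algebra_simps)
    moreover have "real (Suc (Suc k)) *\<^sub>R w s = real (Suc k) *\<^sub>R w s + w s"
      by (simp only: of_nat_Suc[of "Suc k"] scaleR_add_left scaleR_one add.commute)
    ultimately show ?case unfolding s_def by metis
  qed simp
  define u where "u = inverse \<delta> *\<^sub>R w \<delta>"
  have "\<gamma> (\<delta> / real (Suc n)) = \<phi> ((\<delta> / real (Suc n)) *\<^sub>R u)" for n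
  proof -
    have "w \<delta> = real (Suc n) *\<^sub>R w (\<delta> / real (Suc n))" using mult[of n n] by simp
    then have "w (\<delta> / real (Suc n)) = (\<delta> / real (Suc n)) *\<^sub>R u" using \<delta> by (simp add: u_def)
    moreover have "\<bar>\<delta> / real (Suc n)\<bar> < \<epsilon>"
    proof -
      have "\<delta> / real (Suc n) \<le> \<delta> / 1" using \<delta> by (intro divide_left_mono) auto
      moreover have "\<delta> / real (Suc n) > 0" "\<delta> < \<epsilon>" using \<delta> by (simp_all add: \<delta>_def)
      ultimately show ?thesis by linarith
    qed
    ultimately show ?thesis using w by metis
  qed
  then show thesis using that \<delta> by blast
qed

text \<open>The curve \<gamma> is compared with a line only at 0 and at the points \<delta> / (n +
  1). These accumulate at 0, so a derivative within this set is unique, which suffices to identify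
  the two fields.\<close>

lemma subgroup_lie_algebra_torus:
  fixes \<phi> :: "real ^ 'd \<Rightarrow> 'g"
  assumes tc: "torus_coordinates G T \<phi>" and X: "X \<in> subgroup_lie_algebra G T"
  obtains u where "X = translation_field \<phi> u"
proof -
  have hom: "smooth_map euclidean_atlas (atlas G) \<phi>" "\<And>u w. \<phi> (u + w) = \<phi> u \<otimes>\<^bsub>G\<^esub> \<phi> w"
    using tc by (auto simp: torus_coordinates_def)
  obtain \<gamma> where \<gamma>: "one_parameter_subgroup G \<gamma>" "range \<gamma> \<subseteq> T"
    and D: "\<And>f x. f \<in> smooth_functions G \<Longrightarrow> ((\<lambda>s. f (x \<otimes>\<^bsub>G\<^esub> \<gamma> s)) has_vector_derivative X f x) (at 0)"
    and off: "\<And>f. f \<notin> smooth_functions G \<Longrightarrow> X f = 0"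
    using X by (auto simp: subgroup_lie_algebra_def lie_algebra_def)
  obtain \<delta> u where \<delta>: "\<delta> > 0" "\<And>n. \<gamma> (\<delta> / real (Suc n)) = \<phi> ((\<delta> / real (Suc n)) *\<^sub>R u)"
    by (rule one_parameter_subgroup_in_torus[OF tc \<gamma>]) blast
  define S where "S = insert 0 (range (\<lambda>n. \<delta> / real (Suc n)))"
  have eq: "\<gamma> s = \<phi> (s *\<^sub>R u)" if "s \<in> S" for s
  proof (cases "s = 0")
    case True
    have "\<gamma> 0 = \<one>\<^bsub>G\<^esub>"
      using \<gamma>(1) unfolding one_parameter_subgroup_def by (metis add_0 carrier_UNIV UNIV_I l_cancel_one)
    then show ?thesis using True phi_zero[OF hom] by simp
  qed (use that \<delta> in \<open>auto simp: S_def\<close>)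
  have "(\<lambda>n. \<delta> / real (Suc n)) \<longlonglongrightarrow> 0" by (rule lim_const_over_n[THEN LIMSEQ_Suc])
  then have "0 islimpt S"
    unfolding islimpt_sequential using \<delta>(1) by (intro exI[of _ "\<lambda>n. \<delta> / real (Suc n)"]) (auto simp: S_def)
  then have nb: "at 0 within S \<noteq> bot" by (simp add: trivial_limit_within)
  have "X f x = translation_field \<phi> u f x" if f: "f \<in> smooth_functions G" for f x
  proof (rule vector_derivative_unique_within[OF nb])
    show "((\<lambda>s. f (x \<otimes>\<^bsub>G\<^esub> \<gamma> s)) has_vector_derivative X f x) (at 0 within S)"
      by (rule has_vector_derivative_at_within[OF D[OF f]])
    show "((\<lambda>s. f (x \<otimes>\<^bsub>G\<^esub> \<gamma> s)) has_vector_derivative translation_field \<phi> u f x) (at 0 within S)"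
      by (rule has_vector_derivative_transform[OF _ _ has_vector_derivative_at_within[OF
              translation_field_has_derivative[OF hom f]]]) (auto simp: eq S_def)
  qed
  moreover have "X f x = translation_field \<phi> u f x" if "f \<notin> smooth_functions G" for f x
    using off that by (simp add: translation_field_def[OF hom])
  ultimately have "X = translation_field \<phi> u" by (auto simp: fun_eq_iff)
  then show thesis by (rule that)
qed

text \<open>Each coordinate direction closes up at time 1, so \<open>eigenvalue_integral\<close>
  makes \<alpha> of a coordinate field an integer multiple of 2 \<pi> i; \<open>toral_symbol\<close>
  contains the factor i but not 2 \<pi>. Were all these integers 0, then \<alpha> would vanish on
  \<open>cartan G T\<close>, since every field of the torus is a combination of coordinate
  fields.\<close>

lemma root_integer_covector:
  fixes \<phi> :: "real ^ 'd \<Rightarrow> 'g"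
  assumes tc: "torus_coordinates G T \<phi>" and \<alpha>: "\<alpha> \<in> roots G T"
  obtains \<xi> :: "int ^ 'd" where "\<xi> \<noteq> 0"
    "\<And>a. \<alpha> (toral_field G \<phi> a) = 2 * pi * toral_symbol a \<xi>"
proof -
  have smooth: "smooth_map euclidean_atlas (atlas G) \<phi>" and hom: "\<And>u w. \<phi> (u + w) = \<phi> u \<otimes>\<^bsub>G\<^esub> \<phi> w"
    and rng: "range \<phi> = T" and ker: "\<And>u. \<phi> u = \<one>\<^bsub>G\<^esub> \<longleftrightarrow> (\<forall>j. u $ j \<in> \<int>)"
    using tc by (auto simp: torus_coordinates_def)
  define H where "H = translation_field \<phi>"
  note H_add = translation_field_add[OF smooth hom, folded H_def]
  note H_scale = translation_field_scale[OF smooth hom, folded H_def]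
  have H0: "H 0 = 0" using H_scale[of 0 0] by (simp add: cscale_def fun_eq_iff)
  have H_lie: "H u \<in> subgroup_lie_algebra G T" for u
    unfolding H_def using translation_field_in_subgroup_lie_algebra[OF smooth hom] rng by simp
  have cartan: "H u + cscale \<i> (H w) \<in> cartan G T" for u w
    using H_lie by (auto simp: cartan_def complexification_def)
  have H_cartan: "H u \<in> cartan G T" "cscale \<i> (H u) \<in> cartan G T" for u
    using cartan[of u 0] cartan[of 0 u] by (auto simp: H0 cscale_def zero_fun_def[symmetric])
  have a_add: "\<alpha> (X + Y) = \<alpha> X + \<alpha> Y" if "X \<in> cartan G T" "Y \<in> cartan G T" for X Y
    using \<alpha> that by (auto simp: roots_def cartan_dual_def)
  have a_scale: "\<alpha> (cscale a X) = a * \<alpha> X" if "X \<in> cartan G T" for X a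
    using \<alpha> that by (auto simp: roots_def cartan_dual_def)
  define l where "l u = \<alpha> (H u)" for u
  have l_add: "l (u + w) = l u + l w" and l_scale: "l (r *\<^sub>R u) = of_real r * l u" for u w r
    using a_add a_scale H_cartan by (auto simp: l_def H_add H_scale)
  have expand: "(\<Sum>j\<in>UNIV. (u $ j) *\<^sub>R axis j 1) = u" for u :: "real ^ 'd"
    using basis_expansion[of u] by (simp only: scalar_mult_eq_scaleR)
  have "linear l" by (rule linearI) (simp_all only: l_add l_scale scaleR_conv_of_real[where 'a = complex])
  then have l_sum: "l u = (\<Sum>j\<in>UNIV. of_real (u $ j) * l (axis j 1))" for u
    using linear_sum[OF \<open>linear l\<close>, of "\<lambda>j. (u $ j) *\<^sub>R axis j 1" UNIV]
    by (simp add: expand l_scale)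
  have l_cartan: "\<alpha> (H u + cscale \<i> (H w)) = l u + \<i> * l w" for u w
    using a_add[OF H_cartan] a_scale[OF H_cartan(1)] by (simp add: l_def)
  \<comment> \<open>\<open>roots\<close> only asks that the root space differ from {0}. Once 0 is
    known to lie in it, a nonzero element must exist.\<close>
  obtain X where X: "X \<in> root_space G T \<alpha>" "X \<noteq> 0"
  proof -
    have "0 \<in> root_space G T \<alpha>"
    proof -
      have "0 \<in> lie_algebra G"
        using translation_field_in_lie_algebra[OF smooth hom, of 0] H0 by (simp add: H_def)
      then have "0 + cscale \<i> 0 \<in> complexification (lie_algebra G)"
        unfolding complexification_def by blast
      then have "0 \<in> complexification (lie_algebra G)" by (simp add: cvf.scale_zero_right)
      \<comment> \<open>The bracket of \<open>H'\<close> with the zero field evaluates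
        \<open>H'\<close> at the zero function.\<close>
      moreover have "H' 0 = 0" if H': "H' \<in> cartan G T" for H'
      proof -
        have "subgroup_lie_algebra G T \<subseteq> lie_algebra G" by (auto simp: subgroup_lie_algebra_def)
        then obtain Y Z where "Y \<in> lie_algebra G" "Z \<in> lie_algebra G" "H' = Y + cscale \<i> Z"
          using H' unfolding cartan_def complexification_def by blast
        then show ?thesis by (simp add: cscale_def lie_algebra_zero) (simp add: func_zero)
      qed
      ultimately show ?thesis
        by (auto simp: root_space_def lie_bracket_def cscale_def fun_eq_iff)
    qed
    then show thesis using \<alpha> that by (auto simp: roots_def)
  qed
  obtain A B where AB: "A \<in> lie_algebra G" "B \<in> lie_algebra G" and XAB: "X = A + cscale \<i> B"
    using X(1) by (auto simp: root_space_def complexification_def)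
  have Xf: "X f = A f + (\<lambda>x. \<i> * B f x)" for f by (auto simp: XAB cscale_def fun_eq_iff)
  have "\<exists>n::int. l (axis j 1) = 2 * pi * \<i> * of_int n" for j
  proof -
    have "exp (l (axis j 1)) = 1"
    proof (rule eigenvalue_integral[OF smooth hom, of "axis j 1" X])
      show "\<phi> (axis j 1) = \<one>\<^bsub>G\<^esub>" unfolding ker by (simp add: axis_def)
      show "X f \<in> smooth_functions G" if "f \<in> smooth_functions G" for f
        unfolding Xf using AB that
        by (intro smooth_functions_add smooth_functions_scale) (auto simp: lie_algebra_def)
      show "X (f + h) = X f + X h" if "f \<in> smooth_functions G" "h \<in> smooth_functions G" for f h
        unfolding Xf using AB that by (auto simp: lie_algebra_def fun_eq_iff algebra_simps)
      show "X (\<lambda>x. a * f x) = (\<lambda>x. a * X f x)" if "f \<in> smooth_functions G" for a f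
        unfolding Xf using AB that by (auto simp: lie_algebra_def fun_eq_iff algebra_simps)
      show "X f = 0" if "f \<notin> smooth_functions G" for f
        unfolding Xf using AB that by (auto simp: lie_algebra_def fun_eq_iff)
      show "lie_bracket (translation_field \<phi> (axis j 1)) X = cscale (l (axis j 1)) X"
        using X(1) H_cartan(1)[of "axis j 1"] by (simp add: root_space_def l_def H_def)
    qed (fact X(2))
    then obtain n :: int where "Re (l (axis j 1)) = 0" "Im (l (axis j 1)) = of_int (2 * n) * pi"
      unfolding exp_eq_1 by blast
    then show ?thesis by (intro exI[of _ n]) (simp add: complex_eq_iff)
  qed
  then obtain n :: "'d \<Rightarrow> int" where n: "\<And>j. l (axis j 1) = 2 * pi * \<i> * of_int (n j)" by metis
  show thesis
  proof
    show "(\<chi> j. n j) \<noteq> 0"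
    proof
      assume "(\<chi> j. n j) = 0"
      then have "l u = 0" for u by (simp add: l_sum[of u] n vec_eq_iff)
      then have "\<alpha> Y = 0" if Y: "Y \<in> cartan G T" for Y
      proof -
        obtain C D where CD: "C \<in> subgroup_lie_algebra G T" "D \<in> subgroup_lie_algebra G T" "Y = C + cscale \<i> D"
          using Y by (auto simp: cartan_def complexification_def)
        obtain u w where "C = H u" "D = H w"
          unfolding H_def by (meson subgroup_lie_algebra_torus[OF tc] CD)
        then show ?thesis using CD(3) l_cartan \<open>\<And>u. l u = 0\<close> by simp
      qed
      moreover have "\<alpha> Y = 0" if "Y \<notin> cartan G T" for Y
        using \<alpha> that by (auto simp: roots_def cartan_dual_def)
      ultimately have "\<alpha> = 0" by (auto simp: fun_eq_iff)
      then show False using \<alpha> by (simp add: roots_def)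
    qed
    fix a :: "complex ^ 'd"
    \<comment> \<open>\<open>H\<close> takes real vectors only, so the complex coefficients are
      split into real and imaginary parts.\<close>
    define u w where "u = (\<chi> j. Re (a $ j))" and "w = (\<chi> j. Im (a $ j))"
    have H_sum: "H v = (\<Sum>j\<in>UNIV. cscale (of_real (v $ j)) (H (axis j 1)))" for v
    proof -
      have "H (\<Sum>j\<in>J. (v $ j) *\<^sub>R axis j 1) = (\<Sum>j\<in>J. cscale (of_real (v $ j)) (H (axis j 1)))" for J
        by (induction J rule: infinite_finite_induct) (auto simp: H0 H_add H_scale)
      from this[of UNIV] show ?thesis by (simp add: expand)
    qed
    have "toral_field G \<phi> a = (\<Sum>j\<in>UNIV. cscale (a $ j) (H (axis j 1)))"
      by (simp add: toral_field_def coordinate_field_eq[OF tc] H_def)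
    also have "\<dots> = (\<Sum>j\<in>UNIV. cscale (of_real (u $ j)) (H (axis j 1)) +
        cscale \<i> (cscale (of_real (w $ j)) (H (axis j 1))))"
      by (simp add: cvf.scale_left_distrib[symmetric] u_def w_def complex_eq[symmetric])
    also have "\<dots> = H u + cscale \<i> (H w)"
      by (simp add: sum.distrib H_sum[of u] H_sum[of w] cvf.scale_sum_right)
    finally have "\<alpha> (toral_field G \<phi> a) = l u + \<i> * l w" using l_cartan by simp
    also have "\<dots> = (\<Sum>j\<in>UNIV. (of_real (u $ j) + \<i> * of_real (w $ j)) * l (axis j 1))"
      by (simp add: l_sum[of u] l_sum[of w] sum_distrib_left sum.distrib algebra_simps)
    also have "\<dots> = (\<Sum>j\<in>UNIV. a $ j * (2 * pi * \<i> * of_int (n j)))"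
      by (simp add: u_def w_def n complex_eq[symmetric])
    also have "\<dots> = 2 * pi * toral_symbol a (\<chi> j. n j)"
      by (simp add: toral_symbol_def sum_distrib_left mult_ac)
    finally show "\<alpha> (toral_field G \<phi> a) = 2 * pi * toral_symbol a (\<chi> j. n j)" .
  qed
qed

end

section \<open>Failure of the division condition at the covector of the simple root\<close>

theorem theorem2p9:
  fixes G :: "('g::{t2_space,second_countable_topology}, 'e::euclidean_space) lie_data"
    and v :: "'g vfield set"
  assumes "lie_group G"
    and "compact (UNIV :: 'g set)"
    and "connected (UNIV :: 'g set)"
    and "odd DIM('e)"
    and "left_invariant_CR_structure G v"
    and "type_CR1 G v"
  shows "\<forall>T m (\<phi> :: real ^ 'd \<Rightarrow> 'g).
           toral_part G v T m \<longrightarrow> torus_coordinates G T \<phi> \<longrightarrow> \<not> division_condition G \<phi> m"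
proof (intro allI impI notI)
  fix T m and \<phi> :: "real ^ 'd \<Rightarrow> 'g"
  assume "toral_part G v T m" and tc: "torus_coordinates G T \<phi>" and "division_condition G \<phi> m"
  then obtain \<alpha> where \<alpha>: "\<alpha> \<in> roots G T" and m: "\<And>Y. Y \<in> m \<Longrightarrow> \<alpha> Y = 0"
    by (fastforce simp: toral_part_def CR1_presentation_def simple_root_def positive_system_def)
  obtain \<xi> :: "int ^ 'd" where \<xi>: "\<xi> \<noteq> 0" "\<And>a. \<alpha> (toral_field G \<phi> a) = 2 * pi * toral_symbol a \<xi>"
    using root_integer_covector[OF assms(1) tc \<alpha>] by blast
  obtain A C \<rho> where A: "finite A" "cvf.span (toral_field G \<phi> ` A) = m" "m \<noteq> {0}" and "C > 0"
    and bound: "Max ((\<lambda>a. cmod (toral_symbol a \<xi>)) ` A) \<ge> C * (1 + int_vec_norm \<xi>) powr (- \<rho>)"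
    using \<open>division_condition G \<phi> m\<close> \<xi>(1) unfolding division_condition_def by blast
  \<comment> \<open>\<open>Max\<close> of the empty set is unspecified; the clause
    \<open>m \<noteq> {0}\<close> of the division condition excludes this case.\<close>
  have "A \<noteq> {}" using A(2,3) cvf.span_empty by (metis image_empty)
  moreover have "toral_symbol a \<xi> = 0" if "a \<in> A" for a
  proof -
    have "toral_field G \<phi> a \<in> m" 
      using cvf.span_base[OF imageI[OF that, of "toral_field G \<phi>"]] unfolding A(2) .
    then show ?thesis using m \<xi>(2)[of a] by simp
  qed
  ultimately have "Max ((\<lambda>a. cmod (toral_symbol a \<xi>)) ` A) = 0" using A(1) by simp
  moreover have "1 + int_vec_norm \<xi> > 0"
    using norm_ge_zero by (auto simp: int_vec_norm_def intro: add_pos_nonneg)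
  ultimately show False using bound \<open>C > 0\<close> by (smt (verit) mult_pos_pos powr_gt_zero)
qed

end
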